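(* Let $\Bbbk$ be a field, let $n,m\ge 2$, let $\lambda,\mu\in\Bbbk^\times$ with $\lambda,\mu\ne\pm1$, and let $\mathbf p\in\mathcal A_n$, $\mathbf q\in\mathcal A_m$. Then $\mathcal O_{\lambda,\mathbf p}(\mathcal M_n(\Bbbk))\cong\mathcal O_{\mu,\mathbf q}(\mathcal M_m(\Bbbk))$ as $\Bbbk$-algebras if and only if $n=m$ and one of the following cases holds: (1) $\lambda=\mu$ and $\mathbf p=\mathbf q$; (2) $\lambda=\mu$ and $p_{ij}=\lambda^{-1}q_{ji}$ for all $i>j$; (3) $\lambda=\mu^{-1}$ and $p_{ij}=q_{n+1-i,\,n+1-j}$ for all $i,j$; (4) $\lambda=\mu^{-1}$ and $p_{ij}=\lambda^{-1}q_{n+1-j,\,n+1-i}$ for all $i>j$.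
   Context: $\mathcal A_n$ is the set of $n\times n$ matrices $\mathbf p=(p_{ij})$ with entries in $\Bbbk^\times$ such that $p_{ii}=1$ and $p_{ij}=p_{ji}^{-1}$ for all $i\neq j$. For $\lambda\in\Bbbk^\times$ and $\mathbf p\in\mathcal A_n$, the multiparameter quantum $n\times n$ matrix algebra $\mathcal O_{\lambda,\mathbf p}(\mathcal M_n(\Bbbk))$ is the unital associative $\Bbbk$-algebra generated by $X_{ij}$, $1\le i,j\le n$, subject to the relations $$X_{lm}X_{ij}=\begin{cases} p_{li}p_{jm}X_{ij}X_{lm}+(\lambda-1)p_{li}X_{im}X_{lj} & l>i,\ m>j,\\ \lambda p_{li}p_{jm}X_{ij}X_{lm} & l>i,\ m\le j,\\ p_{jm}X_{ij}X_{lm} & l=i,\ m>j.\end{cases}$$ *)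

theory Defs
  imports "HOL-Library.Poly_Mapping" "HOL-Algebra.QuotRing" "HOL-Algebra.Module"
begin

text \<open>The free algebra on a set of letters is the monoid algebra of the free monoid of words.
  The convolution product of \<^type>\<open>poly_mapping\<close> takes the monoid of exponents additively, so
  words are lists whose concatenation is written as addition.\<close>

datatype 'a fword = FWord (letters: "'a list")

instantiation fword :: (type) monoid_add
begin

definition "0 = FWord []"
definition "u + v = FWord (letters u @ letters v)"

instance
  by standard (simp_all add: zero_fword_def plus_fword_def)

end

definition free_algebra :: "'a set \<Rightarrow> ('k::field, 'a fword \<Rightarrow>\<^sub>0 'k) module" where
  "free_algebra S =
     \<lparr>carrier = {f. \<forall>w\<in>Poly_Mapping.keys f. set (letters w) \<subseteq> S},
      mult = (*), one = 1, zero = 0, add = (+),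
      smult = (\<lambda>c f. Poly_Mapping.single 0 c * f)\<rparr>"

definition gen :: "'a \<Rightarrow> ('a fword \<Rightarrow>\<^sub>0 'k::field)" where
  "gen a = Poly_Mapping.single (FWord [a]) 1"

abbreviation scal :: "'k::field \<Rightarrow> ('a fword \<Rightarrow>\<^sub>0 'k)" where
  "scal c \<equiv> Poly_Mapping.single 0 c"

definition quot_algebra :: "('k, 'a, 'z) module_scheme \<Rightarrow> 'a set \<Rightarrow> ('k, 'a set) module" where
  "quot_algebra A I =
     ring.extend (A Quot I) (module.fields (\<lambda>c U. \<Union>x\<in>U. I +>\<^bsub>A\<^esub> (c \<odot>\<^bsub>A\<^esub> x)))"

text \<open>All elements of the type of scalars act, so linearity is required for every scalar.\<close>

definition algebra_iso ::
    "('k, 'a, 'y) module_scheme \<Rightarrow> ('k, 'b, 'z) module_scheme \<Rightarrow> ('a \<Rightarrow> 'b) set" where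
  "algebra_iso A B =
     {h \<in> ring_iso A B. \<forall>c. \<forall>x\<in>carrier A. h (c \<odot>\<^bsub>A\<^esub> x) = c \<odot>\<^bsub>B\<^esub> h x}"

definition is_algebra_iso ::
    "('k, 'a, 'y) module_scheme \<Rightarrow> ('k, 'b, 'z) module_scheme \<Rightarrow> bool" where
  "is_algebra_iso A B \<longleftrightarrow> algebra_iso A B \<noteq> {}"

text \<open>An \<open>n \<times> n\<close> matrix is a function of which only the entries with both indices
  in \<open>{1..n}\<close> matter.\<close>

definition param_matrix :: "nat \<Rightarrow> (nat \<Rightarrow> nat \<Rightarrow> 'k::field) \<Rightarrow> bool" where
  "param_matrix n p \<longleftrightarrow>
     (\<forall>i\<in>{1..n}. \<forall>j\<in>{1..n}. p i j \<noteq> 0) \<and>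
     (\<forall>i\<in>{1..n}. p i i = 1) \<and>
     (\<forall>i\<in>{1..n}. \<forall>j\<in>{1..n}. i \<noteq> j \<longrightarrow> p i j = inverse (p j i))"

abbreviation gen2 :: "nat \<Rightarrow> nat \<Rightarrow> ((nat \<times> nat) fword \<Rightarrow>\<^sub>0 'k::field)" where
  "gen2 i j \<equiv> gen (i, j)"

definition qmat_relations ::
    "nat \<Rightarrow> 'k::field \<Rightarrow> (nat \<Rightarrow> nat \<Rightarrow> 'k) \<Rightarrow> ((nat \<times> nat) fword \<Rightarrow>\<^sub>0 'k) set" where
  "qmat_relations n lam p =
     {gen2 l m * gen2 i j - (scal (p l i * p j m) * (gen2 i j * gen2 l m)
                             + scal ((lam - 1) * p l i) * (gen2 i m * gen2 l j))
       | l m i j. {l, m, i, j} \<subseteq> {1..n} \<and> l > i \<and> m > j} \<union>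
     {gen2 l m * gen2 i j - scal (lam * p l i * p j m) * (gen2 i j * gen2 l m)
       | l m i j. {l, m, i, j} \<subseteq> {1..n} \<and> l > i \<and> m \<le> j} \<union>
     {gen2 l m * gen2 i j - scal (p j m) * (gen2 i j * gen2 l m)
       | l m i j. {l, m, i, j} \<subseteq> {1..n} \<and> l = i \<and> m > j}"

definition qmat_algebra ::
    "nat \<Rightarrow> 'k::field \<Rightarrow> (nat \<Rightarrow> nat \<Rightarrow> 'k) \<Rightarrow> ('k, ((nat \<times> nat) fword \<Rightarrow>\<^sub>0 'k) set) module" where
  "qmat_algebra n lam p =
     (let F = free_algebra ({1..n} \<times> {1..n})
      in quot_algebra F (Idl\<^bsub>F\<^esub> (qmat_relations n lam p)))"

lemma mult_in_free_algebra:
  assumes "f \<in> carrier (free_algebra S)" "g \<in> carrier (free_algebra S)"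
  shows "f * g \<in> carrier (free_algebra S)"
proof -
  have "set (letters w) \<subseteq> S" if "w \<in> Poly_Mapping.keys (f * g)" for w
  proof -
    from that keys_mult[of f g] obtain u v
      where "w = u + v" "u \<in> Poly_Mapping.keys f" "v \<in> Poly_Mapping.keys g"
      by blast
    then show ?thesis
      using assms by (simp add: free_algebra_def plus_fword_def)
  qed
  then show ?thesis
    by (simp add: free_algebra_def)
qed

lemma add_in_free_algebra:
  assumes "f \<in> carrier (free_algebra S)" "g \<in> carrier (free_algebra S)"
  shows "f + g \<in> carrier (free_algebra S)"
  using assms Poly_Mapping.keys_add[of f g] unfolding free_algebra_def by (simp, blast)

lemma ring_free_algebra: "ring (free_algebra S :: ('k::field, 'a fword \<Rightarrow>\<^sub>0 'k) module)"
proof (rule ringI)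
  let ?F = "free_algebra S :: ('k, 'a fword \<Rightarrow>\<^sub>0 'k) module"
  have ops [simp]: "f \<otimes>\<^bsub>?F\<^esub> g = f * g" "f \<oplus>\<^bsub>?F\<^esub> g = f + g" "\<one>\<^bsub>?F\<^esub> = 1" "\<zero>\<^bsub>?F\<^esub> = 0" for f g
    by (simp_all add: free_algebra_def)
  show "abelian_group ?F"
  proof (rule abelian_groupI)
    fix f assume "f \<in> carrier ?F"
    then have "- f \<in> carrier ?F"
      by (simp add: free_algebra_def)
    then show "\<exists>g\<in>carrier ?F. g \<oplus>\<^bsub>?F\<^esub> f = \<zero>\<^bsub>?F\<^esub>"
      by (rule bexI[rotated]) simp
  next
    show "\<zero>\<^bsub>?F\<^esub> \<in> carrier ?F"
      by (simp add: free_algebra_def)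
  qed (simp_all add: add_in_free_algebra ac_simps)
  show "Group.monoid ?F"
  proof (rule monoidI)
    show "\<one>\<^bsub>?F\<^esub> \<in> carrier ?F"
      by (simp add: free_algebra_def zero_fword_def flip: single_one)
  qed (simp_all add: mult_in_free_algebra mult.assoc)
  show "(f \<oplus>\<^bsub>?F\<^esub> g) \<otimes>\<^bsub>?F\<^esub> h = f \<otimes>\<^bsub>?F\<^esub> h \<oplus>\<^bsub>?F\<^esub> g \<otimes>\<^bsub>?F\<^esub> h" for f g h
    by (simp add: distrib_right)
  show "h \<otimes>\<^bsub>?F\<^esub> (f \<oplus>\<^bsub>?F\<^esub> g) = h \<otimes>\<^bsub>?F\<^esub> f \<oplus>\<^bsub>?F\<^esub> h \<otimes>\<^bsub>?F\<^esub> g" for f g h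
    by (simp add: distrib_left)
qed

lemma scal_in_free_algebra: "scal c \<in> carrier (free_algebra S)"
  by (simp add: free_algebra_def zero_fword_def)

lemma gen_in_free_algebra: "a \<in> S \<Longrightarrow> gen a \<in> carrier (free_algebra S)"
  by (simp add: free_algebra_def gen_def)

lemma diff_in_free_algebra:
  assumes "f \<in> carrier (free_algebra S)" "g \<in> carrier (free_algebra S)"
  shows "f - g \<in> carrier (free_algebra S)"
  using assms keys_diff[of f g] unfolding free_algebra_def by (simp, blast)

lemma qmat_relations_subset:
  "qmat_relations n lam p \<subseteq> carrier (free_algebra ({1..n} \<times> {1..n}))" (is "_ \<subseteq> carrier ?F")
proof -
  have gen2: "gen2 i j \<in> carrier ?F" if "i \<in> {1..n}" "j \<in> {1..n}" for i j
    using that by (intro gen_in_free_algebra) simp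
  show ?thesis
    unfolding qmat_relations_def
    by (intro Un_least subsetI; clarify;
        intro diff_in_free_algebra add_in_free_algebra mult_in_free_algebra
          scal_in_free_algebra gen2; blast)
qed

lemma quot_algebra_simps [simp]:
  "carrier (quot_algebra A I) = carrier (A Quot I)"
  "mult (quot_algebra A I) = mult (A Quot I)"
  "one (quot_algebra A I) = one (A Quot I)"
  "zero (quot_algebra A I) = zero (A Quot I)"
  "add (quot_algebra A I) = add (A Quot I)"
  "smult (quot_algebra A I) c U = (\<Union>x\<in>U. I +>\<^bsub>A\<^esub> (c \<odot>\<^bsub>A\<^esub> x))"
  by (simp_all add: quot_algebra_def ring.extend_def module.fields_def)

lemma smult_quot_free_algebra:
  fixes S :: "'a set" and f :: "'a fword \<Rightarrow>\<^sub>0 'k::field"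
  defines "F \<equiv> free_algebra S"
  assumes I: "ideal I F" and f: "f \<in> carrier F"
  shows "c \<odot>\<^bsub>quot_algebra F I\<^esub> (I +>\<^bsub>F\<^esub> f) = I +>\<^bsub>F\<^esub> (c \<odot>\<^bsub>F\<^esub> f)"
proof -
  interpret ideal I F by (rule I)
  have sm: "c \<odot>\<^bsub>F\<^esub> x = scal c \<otimes>\<^bsub>F\<^esub> x" for x
    by (simp add: F_def free_algebra_def)
  have sc: "scal c \<in> carrier F"
    by (simp add: F_def scal_in_free_algebra)
  have eq: "I +>\<^bsub>F\<^esub> (scal c \<otimes>\<^bsub>F\<^esub> x) = I +>\<^bsub>F\<^esub> (scal c \<otimes>\<^bsub>F\<^esub> f)" if x: "x \<in> I +>\<^bsub>F\<^esub> f" for x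
  proof -
    from x obtain a where a: "a \<in> I" "x = a \<oplus>\<^bsub>F\<^esub> f"
      by (auto simp: a_r_coset_def')
    have aC: "a \<in> carrier F" using a a_subset by auto
    have "scal c \<otimes>\<^bsub>F\<^esub> x = scal c \<otimes>\<^bsub>F\<^esub> a \<oplus>\<^bsub>F\<^esub> scal c \<otimes>\<^bsub>F\<^esub> f"
      using a aC f sc by (simp add: r_distr)
    also have "\<dots> \<in> I +>\<^bsub>F\<^esub> (scal c \<otimes>\<^bsub>F\<^esub> f)"
      using I_l_closed[OF a(1) sc] by (auto simp: a_r_coset_def')
    finally show ?thesis
      using f sc by (intro a_repr_independence'[symmetric]) simp_all
  qed
  have "f \<in> I +>\<^bsub>F\<^esub> f"
    using f by (rule a_rcos_self)
  then have "(\<Union>x\<in>I +>\<^bsub>F\<^esub> f. I +>\<^bsub>F\<^esub> (scal c \<otimes>\<^bsub>F\<^esub> x)) = I +>\<^bsub>F\<^esub> (scal c \<otimes>\<^bsub>F\<^esub> f)"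
    using eq by blast
  then show ?thesis
    unfolding quot_algebra_simps sm .
qed

lemma ring_quot_algebra:
  assumes "ideal I A"
  shows "ring (quot_algebra A I)"
proof -
  interpret Q: ring "A Quot I"
    using assms by (rule ideal.quotient_is_ring)
  show ?thesis
  proof (rule ringI)
    show "abelian_group (quot_algebra A I)"
    proof (rule abelian_groupI)
      fix x assume "x \<in> carrier (quot_algebra A I)"
      then have x: "x \<in> carrier (A Quot I)"
        by simp
      show "\<exists>y\<in>carrier (quot_algebra A I). y \<oplus>\<^bsub>quot_algebra A I\<^esub> x = \<zero>\<^bsub>quot_algebra A I\<^esub>"
        using Q.l_neg[OF x] Q.a_inv_closed[OF x] by auto
    qed (simp_all add: Q.add.m_ac)
    show "monoid (quot_algebra A I)"
      by (rule monoidI) (simp_all add: Q.m_assoc)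
  qed (simp_all add: Q.l_distr Q.r_distr)
qed

lemma ring_qmat_algebra: "ring (qmat_algebra n lam p)"
  unfolding qmat_algebra_def Let_def
  by (intro ring_quot_algebra ring.genideal_ideal ring_free_algebra qmat_relations_subset)

end

theory Submission
  imports Defs "HOL.Vector_Spaces" "HOL-Library.Function_Algebras"
begin

text \<open>Only degrees at most two of the algebras are needed. The dual of the degree two part consists
  of the bilinear forms on generators which satisfy the defining relations (\<open>quad_dual\<close>).

  An isomorphism sends each generator to a constant plus a linear part plus higher terms. The linear
  parts are linearly independent by counting dimensions of cotangent spaces, and then the linear
  terms of the relations force all constants to vanish, because the parameter is not 1. So the linear
  parts give an isomorphism of degree one parts respecting the quadratic relations.

  The weights \<open>X\<^sub>i\<^sub>j \<mapsto> \<alpha>\<^sub>i + \<beta>\<^sub>j\<close> act as derivations of degree zero. Conversely, every derivation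
  of degree zero is diagonal in the generators. Transporting the weight derivations through the
  isomorphism therefore yields diagonal matrices, and since the weights separate the generators, the
  linear part is monomial: it permutes the generators up to scalars. The relations with three terms
  show that this permutation maps the diagonal and the antidiagonal of each two by two minor to those
  of another minor, which leaves only the identity, the transposition, the rotation by 180 degrees and
  their product. The parameters are compared by means of the relations within a row or a column.\<close>

section \<open>Quadratic forms dual to the relations and their derivations\<close>

text \<open>No basis of ordered monomials is established. Independence in degree two is witnessed by
  explicit forms (\<open>pair_form\<close> and its variant for the antidiagonal): a form satisfying
  the relations is a functional on the quotient, so evaluating it is enough to isolate a single
  coefficient. The arguments therefore run contravariantly, on forms instead of elements.

  Derivations are used instead of automorphisms of degree zero because they obey linear equations
  and do not see discrete symmetries. Transposition may itself be an automorphism, so automorphisms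
  of degree zero need not be diagonal. Moreover, weights with values 0 and 1 separate rows and
  columns over every field, finite ones included.

  The condition \<open>lam \<noteq> 1\<close> enters in two ways: the coefficient
  \<open>lam - 1\<close> of the antidiagonal product can be cancelled, and equations such as
  \<open>d = c * d\<close> and \<open>d = lam * c * d\<close>, coming from different kinds of
  relations, leave only \<open>d = 0\<close>.\<close>

definition idx :: "nat \<Rightarrow> (nat \<times> nat) set" where
  "idx n = {1..n} \<times> {1..n}"

lemma finite_idx [simp]: "finite (idx n)"
  by (simp add: idx_def)

definition quad_dual :: "nat \<Rightarrow> 'k::field \<Rightarrow> (nat \<Rightarrow> nat \<Rightarrow> 'k) \<Rightarrow> (nat \<times> nat \<Rightarrow> nat \<times> nat \<Rightarrow> 'k) \<Rightarrow> bool" where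
  "quad_dual n lam p b \<longleftrightarrow>
    (\<forall>l\<in>{1..n}. \<forall>m\<in>{1..n}. \<forall>i\<in>{1..n}. \<forall>j\<in>{1..n}.
      (i < l \<and> j < m \<longrightarrow> b (l, m) (i, j) =
          p l i * p j m * b (i, j) (l, m) + (lam - 1) * p l i * b (i, m) (l, j)) \<and>
      (i < l \<and> m \<le> j \<longrightarrow> b (l, m) (i, j) = lam * p l i * p j m * b (i, j) (l, m)) \<and>
      (l = i \<and> j < m \<longrightarrow> b (l, m) (i, j) = p j m * b (i, j) (l, m)))"

text \<open>The functional dual to the ordered product of \<open>u\<close> and \<open>v\<close>;
  \<open>k\<close> is the value that a commutation relation forces on the reversed product.\<close>

definition pair_form :: "'i \<Rightarrow> 'i \<Rightarrow> 'k \<Rightarrow> 'i \<Rightarrow> 'i \<Rightarrow> 'k::field" where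
  "pair_form u v k x y = (if x = u \<and> y = v then 1 else if x = v \<and> y = u then k else 0)"

lemma quad_dual_square: "quad_dual n lam p (pair_form u u 1)"
  unfolding quad_dual_def pair_form_def by (cases u) auto

lemma quad_dual_row:
  "j < m \<Longrightarrow> quad_dual n lam p (pair_form (i, j) (i, m) (p j m))"
  unfolding quad_dual_def pair_form_def by auto

lemma quad_dual_col:
  assumes "param_matrix n p" "i < l" "j \<in> {1..n}"
  shows "quad_dual n lam p (pair_form (i, j) (l, j) (lam * p l i))"
proof -
  have "p j j = 1" using assms unfolding param_matrix_def by blast
  then show ?thesis using assms(2) unfolding quad_dual_def pair_form_def by auto
qed

lemma quad_dual_diag:
  "i < l \<Longrightarrow> j < m \<Longrightarrow> quad_dual n lam p (pair_form (i, j) (l, m) (p l i * p j m))"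
  unfolding quad_dual_def pair_form_def by auto

text \<open>The antidiagonal product also occurs in the three term relation of its minor, so the
  dual functional needs a third entry, at the reversed diagonal product.\<close>

lemma quad_dual_anti:
  assumes "i < l" "j < m"
  shows "quad_dual n lam p (\<lambda>x y. pair_form (i, m) (l, j) (lam * p l i * p m j) x y
    + (if x = (l, m) \<and> y = (i, j) then (lam - 1) * p l i else 0))"
  using assms unfolding quad_dual_def pair_form_def by auto

text \<open>\<open>D x e\<close> is the coefficient of \<open>e\<close> in the image of \<open>x\<close>, and \<open>der_form\<close> is the dual action of
  \<open>D \<otimes> 1 + 1 \<otimes> D\<close>.\<close>

definition der_form :: "'i set \<Rightarrow> ('i \<Rightarrow> 'i \<Rightarrow> 'k::field) \<Rightarrow> ('i \<Rightarrow> 'i \<Rightarrow> 'k) \<Rightarrow> 'i \<Rightarrow> 'i \<Rightarrow> 'k" where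
  "der_form S D b x y = (\<Sum>e\<in>S. D x e * b e y) + (\<Sum>e\<in>S. D y e * b x e)"

lemma der_form_pair:
  assumes "finite S" "u \<in> S" "v \<in> S" "u \<noteq> v"
  shows "der_form S D (pair_form u v k) x y =
    (if y = v then D x u else if y = u then k * D x v else 0) +
    (if x = u then D y v else if x = v then k * D y u else 0)"
proof -
  have "(\<Sum>e\<in>S. D x e * pair_form u v k e y) =
      (\<Sum>e\<in>S. (if e = u then if y = v then D x u else 0 else 0) + (if e = v then if y = u then k * D x v else 0 else 0))"
    using assms(4) by (intro sum.cong) (auto simp: pair_form_def)
  moreover have "(\<Sum>e\<in>S. D y e * pair_form u v k x e) =
      (\<Sum>e\<in>S. (if e = v then if x = u then D y v else 0 else 0) + (if e = u then if x = v then k * D y u else 0 else 0))"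
    using assms(4) by (intro sum.cong) (auto simp: pair_form_def)
  ultimately show ?thesis
    using assms unfolding der_form_def sum.distrib by simp
qed

lemma der_form_square:
  assumes "finite S" "u \<in> S"
  shows "der_form S D (pair_form u u 1) x y = (if y = u then D x u else 0) + (if x = u then D y u else 0)"
proof -
  have "(\<Sum>e\<in>S. D x e * pair_form u u 1 e y) = (\<Sum>e\<in>S. if e = u then if y = u then D x u else 0 else 0)"
    "(\<Sum>e\<in>S. D y e * pair_form u u 1 x e) = (\<Sum>e\<in>S. if e = u then if x = u then D y u else 0 else 0)"
    by (auto intro!: sum.cong simp: pair_form_def)
  then show ?thesis
    using assms unfolding der_form_def by simp
qed

lemma quad_dual_detD:
  assumes "quad_dual n lam p b" "{i, l, j, m} \<subseteq> {1..n}" "i < l" "j < m"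
  shows "b (l, m) (i, j) = p l i * p j m * b (i, j) (l, m) + (lam - 1) * p l i * b (i, m) (l, j)"
  using assms unfolding quad_dual_def by blast

lemma quad_dual_antiD:
  assumes "quad_dual n lam p b" "{i, l, j, m} \<subseteq> {1..n}" "i < l" "j < m"
  shows "b (l, j) (i, m) = lam * p l i * p m j * b (i, m) (l, j)"
  using assms unfolding quad_dual_def by (meson insert_subset less_imp_le)

lemma quad_dual_rowD:
  assumes "quad_dual n lam p b" "{i, j, m} \<subseteq> {1..n}" "j < m"
  shows "b (i, m) (i, j) = p j m * b (i, j) (i, m)"
  using assms unfolding quad_dual_def by blast

lemma quad_dual_colD:
  assumes "quad_dual n lam p b" "{i, l, j} \<subseteq> {1..n}" "i < l" "param_matrix n p"
  shows "b (l, j) (i, j) = lam * p l i * b (i, j) (l, j)"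
proof -
  have "p j j = 1" using assms unfolding param_matrix_def by blast
  moreover have "b (l, j) (i, j) = lam * p l i * p j j * b (i, j) (l, j)"
    using assms unfolding quad_dual_def by (meson insert_subset le_refl)
  ultimately show ?thesis by simp
qed

lemma param_matrix_nz: "param_matrix n p \<Longrightarrow> {i, j} \<subseteq> {1..n} \<Longrightarrow> p i j \<noteq> 0"
  unfolding param_matrix_def by blast

lemma param_matrix_inv:
  assumes "param_matrix n p" "{i, j} \<subseteq> {1..n}" shows "p i j * p j i = 1"
proof (cases "i = j")
  case False
  then have "p i j = inverse (p j i)" "p j i \<noteq> 0" using assms unfolding param_matrix_def by blast+
  then show ?thesis by simp
qed (use assms in \<open>auto simp: param_matrix_def\<close>)

text \<open>Dual form of the condition that \<open>D\<close> extends to a derivation of the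
  quadratic algebra: instead of mapping relations to combinations of relations, it preserves the
  forms that vanish on them.\<close>

definition quad_derivation where
  "quad_derivation n lam p D \<longleftrightarrow>
    (\<forall>b. quad_dual n lam p b \<longrightarrow> quad_dual n lam p (der_form (idx n) D b))"

text \<open>Each of the following lemmas applies \<open>D\<close> to a relation and compares coefficients of one
  normally ordered monomial, namely the one to which the chosen form is dual.\<close>

lemma quad_derivation_anti:
  assumes D: "quad_derivation n lam p D" and p: "param_matrix n p" and lam: "lam \<noteq> 1"
    and ij: "{i, l, j, m} \<subseteq> {1..n}" "i < l" "j < m"
  shows "D (i, m) (l, j) = 0" "D (l, j) (i, m) = 0"
proof -
  have e: "quad_dual n lam p (der_form (idx n) D (pair_form e e 1))" for e
    using D quad_dual_square unfolding quad_derivation_def by blast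
  have "p l i \<noteq> 0" using param_matrix_nz[OF p] ij by blast
  \<comment> \<open>The form dual to the square of an antidiagonal generator, after applying
    \<open>D\<close>, vanishes on both diagonal products. Only the summand with the nonzero factor
    \<open>(lam - 1) * p l i\<close> survives.\<close>
  then show "D (i, m) (l, j) = 0" "D (l, j) (i, m) = 0"
    using quad_dual_detD[OF e[of "(l,j)"] ij] quad_dual_detD[OF e[of "(i,m)"] ij] ij lam
    by (auto simp: der_form_square idx_def)
qed

lemma quad_derivation_diag:
  assumes D: "quad_derivation n lam p D" and p: "param_matrix n p" and lam: "lam \<noteq> 1"
    and ij: "{i, l, j, m} \<subseteq> {1..n}" "i < l" "j < m"
  shows "D (i, j) (l, m) = 0" "D (l, m) (i, j) = 0"
proof -
  have e: "quad_dual n lam p (der_form (idx n) D (pair_form e e 1))" for e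
    using D quad_dual_square unfolding quad_derivation_def by blast
  have r: "quad_dual n lam p (der_form (idx n) D (pair_form (i, j) (i, m) (p j m)))" for i
    using D quad_dual_row ij unfolding quad_derivation_def by blast
  \<comment> \<open>The square form gives the first equation and the row form the second. Their
    factors differ by \<open>lam\<close>, so a nonzero \<open>d\<close> cannot satisfy both.\<close>
  have *: "d = 0" if "d = p l i * p j m * d" "d = lam * p l i * p j m * d" for d
    using that lam by (metis (no_types, lifting) mult.assoc mult_cancel_right1)
  show "D (i, j) (l, m) = 0" "D (l, m) (i, j) = 0"
    using quad_dual_detD[OF e[of "(l,m)"] ij] quad_dual_detD[OF e[of "(i,j)"] ij] ij lam 
      quad_dual_colD[OF r[of i] _ ij(2) p, of m]
      quad_dual_colD[OF r[of l] _ ij(2) p, of j]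
    by (auto intro!: * simp: der_form_square der_form_pair idx_def ac_simps)
qed

lemma quad_derivation_row:
  assumes D: "quad_derivation n lam p D" and p: "param_matrix n p" and lam: "lam \<noteq> 1"
    and ij: "{i, l, j} \<subseteq> {1..n}" "i \<noteq> l" and n: "n \<ge> 2"
  shows "D (i, j) (l, j) = 0"
proof -
  have e: "quad_dual n lam p (der_form (idx n) D (pair_form e e 1))" for e
    using D quad_dual_square unfolding quad_derivation_def by blast
  have r: "quad_dual n lam p (der_form (idx n) D (pair_form (i, j) (i, m) (p j m)))" if "j < m" for i j m
    using D quad_dual_row that unfolding quad_derivation_def by blast
  have d: "quad_dual n lam p (der_form (idx n) D (pair_form (i, j) (l, m) (p l i * p j m)))" 
    if "i < l" "j < m" for i j l m
    using D quad_dual_diag that unfolding quad_derivation_def by blast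
  have *: "d = 0" if "d = q * d" "d = lam * q * d" for d q
    using that lam by (metis (no_types, lifting) mult.assoc mult_cancel_right1)
  have up: "D (l, j) (i, j) = 0" "D (l, m) (i, m) = 0" 
    if ij: "{i, l, j, m} \<subseteq> {1..n}" "i < l" "j < m" for i j l m
  proof -
    have nz: "p j m \<noteq> 0" using param_matrix_nz[OF p] ij by blast
    have 1: "D (l, k) (i, k) = lam * p l i * D (l, k) (i, k)" if "k = j \<or> k = m" for k
      using quad_dual_colD[OF e[of "(i,k)"] _ ij(2) p, of k] ij that
      by (auto simp: der_form_square idx_def)
    have 2: "D (l, j) (i, j) = p l i * D (l, j) (i, j)"
      using quad_dual_rowD[OF d[OF ij(2,3)] _ ij(3), of l] ij nz
      by (auto simp: der_form_pair idx_def)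
    show 3: "D (l, j) (i, j) = 0" using 2 1[of j] * by blast
    \<comment> \<open>The three term summand contributes \<open>D (l, j) (i, j)\<close>. It is
      already known to vanish, which is why column \<open>j\<close> is treated before column
      \<open>m\<close>; for \<open>dn\<close> the order is reversed.\<close>
    have "D (l, m) (i, m) = p l i * D (l, m) (i, m)"
      using quad_dual_detD[OF r[OF ij(3)] ij, of i] ij nz 3
      by (auto simp: der_form_pair idx_def)
    then show "D (l, m) (i, m) = 0" using 1[of m] * by blast
  qed
  have dn: "D (i, j) (l, j) = 0" "D (i, m) (l, m) = 0" 
    if ij: "{i, l, j, m} \<subseteq> {1..n}" "i < l" "j < m" for i j l m
  proof -
    have nz: "p j m \<noteq> 0" using param_matrix_nz[OF p] ij by blast
    have 1: "D (i, k) (l, k) = lam * p l i * D (i, k) (l, k)" if "k = j \<or> k = m" for k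
      using quad_dual_colD[OF e[of "(l,k)"] _ ij(2) p, of k] ij that
      by (auto simp: der_form_square idx_def)
    have 2: "D (i, m) (l, m) = p l i * D (i, m) (l, m)"
      using quad_dual_rowD[OF d[OF ij(2,3)] _ ij(3), of i] ij nz
      by (auto simp: der_form_pair idx_def)
    show 3: "D (i, m) (l, m) = 0" using 2 1[of m] * by blast
    have "D (i, j) (l, j) = p l i * D (i, j) (l, j)"
      using quad_dual_detD[OF r[OF ij(3)] ij, of l] ij nz 3
      by (auto simp: der_form_pair idx_def)
    then show "D (i, j) (l, j) = 0" using 1[of j] * by blast
  qed
  \<comment> \<open>A minor requires a second column. Whether it lies to the left or to the right of
    \<open>j\<close> decides which half of \<open>up\<close> or \<open>dn\<close> applies.\<close>
  obtain j' where j': "j' \<in> {1..n}" "j' \<noteq> j"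
    using n that[of 1] that[of 2] by (cases "j = 1") auto
  consider "i < l" "j < j'" | "i < l" "j' < j" | "l < i" "j < j'" | "l < i" "j' < j"
    using ij j' by (meson linorder_neqE_nat)
  then show ?thesis
  proof cases
    case 1
    show ?thesis by (rule dn(1)[OF _ 1]) (use ij j' in simp)
  next
    case 2
    show ?thesis by (rule dn(2)[OF _ 2]) (use ij j' in simp)
  next
    case 3
    show ?thesis by (rule up(1)[OF _ 3]) (use ij j' in simp)
  next
    case 4
    show ?thesis by (rule up(2)[OF _ 4]) (use ij j' in simp)
  qed
qed

text \<open>The parameters after renaming \<open>(i, j)\<close> to \<open>(j, i)\<close>: a column
  relation with factor \<open>lam * p l i\<close> becomes a row relation, which puts
  \<open>lam\<close> above the diagonal and its inverse below.\<close>

definition transpose_params :: "'k::field \<Rightarrow> (nat \<Rightarrow> nat \<Rightarrow> 'k) \<Rightarrow> nat \<Rightarrow> nat \<Rightarrow> 'k" where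
  "transpose_params lam p i j =
    (if j < i then inverse lam * p j i else if i < j then lam * p j i else 1)"

lemma param_matrix_transpose:
  assumes "param_matrix n p" "lam \<noteq> 0"
  shows "param_matrix n (transpose_params lam p)"
proof -
  have "transpose_params lam p i j \<noteq> 0" if "{i, j} \<subseteq> {1..n}" for i j
    using param_matrix_nz[OF assms(1), of j i] that assms(2) by (auto simp: transpose_params_def)
  moreover have "transpose_params lam p i j * transpose_params lam p j i = 1"
    if "{i, j} \<subseteq> {1..n}" "i \<noteq> j" for i j
    using param_matrix_inv[OF assms(1), of i j] that assms(2)
    by (cases i j rule: linorder_cases) (auto simp: transpose_params_def field_simps)
  then have "transpose_params lam p i j = inverse (transpose_params lam p j i)"
    if "{i, j} \<subseteq> {1..n}" "i \<noteq> j" for i j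
    using that inverse_unique[of "transpose_params lam p j i" "transpose_params lam p i j"]
    by (metis insert_commute)
  moreover have "transpose_params lam p i i = 1" for i
    by (simp add: transpose_params_def)
  ultimately show ?thesis unfolding param_matrix_def by (intro conjI ballI impI) blast+
qed

definition swap_form :: "(nat \<times> nat \<Rightarrow> nat \<times> nat \<Rightarrow> 'k) \<Rightarrow> nat \<times> nat \<Rightarrow> nat \<times> nat \<Rightarrow> 'k" where
  "swap_form b x y = b (prod.swap x) (prod.swap y)"

text \<open>Transposition reverses the order of the antidiagonal product in a three term relation.
  Reordering it by the antidiagonal relation restores the standard shape, and
  \<open>transpose_params\<close> absorbs the resulting factor.\<close>

lemma quad_dual_transpose:
  assumes p: "param_matrix n p" and lam: "lam \<noteq> 0" and b: "quad_dual n lam p b"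
  shows "quad_dual n lam (transpose_params lam p) (swap_form b)"
proof -
  have a: "b (m, l) (j, i) = transpose_params lam p l i * transpose_params lam p j m * b (j, i) (m, l) +
       (lam - 1) * transpose_params lam p l i * b (m, i) (j, l)" 
       if "{i, l, j, m} \<subseteq> {1..n}" "i < l" "j < m" for i l j m
  proof -
    have "p i l * p l i = 1" "lam * inverse lam = 1"
      using param_matrix_inv[OF p] that lam by auto
    moreover have "b (m, l) (j, i) = p m j * p i l * b (j, i) (m, l) + (lam - 1) * p m j * b (j, l) (m, i)"
      "b (m, i) (j, l) = lam * p m j * p l i * b (j, l) (m, i)"
      using quad_dual_detD[OF b, of j m i l] quad_dual_antiD[OF b, of j m i l] that by auto
    moreover have "transpose_params lam p l i = inverse lam * p i l" "transpose_params lam p j m = lam * p m j"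
      using that by (auto simp: transpose_params_def)
    moreover have "pm * P * x + (lam - 1) * pm * y = u * P * (lam * pm) * x + (lam - 1) * (u * P) * (lam * pm * R * y)"
      if "P * R = 1" "lam * u = 1" for P R u x y pm
    proof -
      have "u * P * (lam * pm) * x + (lam - 1) * (u * P) * (lam * pm * R * y) =
          (lam * u) * (pm * P * x) + (lam * u) * ((P * R) * ((lam - 1) * (pm * y)))"
        by (simp only: ac_simps)
      then show ?thesis using that by (simp add: mult.assoc)
    qed
    ultimately show ?thesis by simp
  qed
  moreover have "b (m, l) (j, i) = lam * transpose_params lam p l i * transpose_params lam p j m * b (j, i) (m, l)"
   if "{i, l, j, m} \<subseteq> {1..n}" "i < l" "m \<le> j" for i l j m
  proof (cases "m = j")
    case True
    then show ?thesis using quad_dual_rowD[OF b, of j i l] that lam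
      by (simp add: transpose_params_def)
  next
    case False
    have "p i l * p l i = 1" "p j m * p m j = 1" "lam * inverse lam = 1"
      using param_matrix_inv[OF p] that lam by auto
    moreover have "b (j, i) (m, l) = lam * p j m * p l i * b (m, l) (j, i)"
      using quad_dual_antiD[OF b, of m j i l] that False by auto
    moreover have "transpose_params lam p l i = inverse lam * p i l" "transpose_params lam p j m = inverse lam * p m j"
      using that False by (auto simp: transpose_params_def)
    moreover have "x = lam * (u * P) * (u * S) * (lam * T * R * x)"
      if "P * R = 1" "T * S = 1" "lam * u = 1" for P R S T u x
    proof -
      have "lam * (u * P) * (u * S) * (lam * T * R * x) = (lam * u) * ((lam * u) * ((P * R) * ((T * S) * x)))"
        by (simp only: ac_simps)
      then show ?thesis using that by simp
    qed
    ultimately show ?thesis by simp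
  qed
  moreover have "b (m, l) (j, l) = transpose_params lam p j m * b (j, l) (m, l)"
   if "{l, j, m} \<subseteq> {1..n}" "j < m" for l j m
   using quad_dual_colD[OF b, of j m l] that p by (auto simp: transpose_params_def)
  ultimately show ?thesis unfolding quad_dual_def swap_form_def by auto
qed

lemma transpose_params_twice:
  assumes "param_matrix n p" "lam \<noteq> 0" "i \<in> {1..n}" "j \<in> {1..n}"
  shows "transpose_params lam (transpose_params lam p) i j = p i j"
proof -
  have "p i i = 1" using assms unfolding param_matrix_def by blast
  then show ?thesis
    using assms(2) by (cases i j rule: linorder_cases) (auto simp: transpose_params_def)
qed

lemma quad_dual_cong:
  assumes "\<And>i j. i \<in> {1..n} \<Longrightarrow> j \<in> {1..n} \<Longrightarrow> p i j = p' i j"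
  shows "quad_dual n lam p b = quad_dual n lam p' b"
  using assms unfolding quad_dual_def by auto

text \<open>This symmetry reduces two generators in one row to two generators in one column.\<close>

lemma quad_derivation_transpose:
  assumes p: "param_matrix n p" and lam: "lam \<noteq> 0" and D: "quad_derivation n lam p D"
  shows "quad_derivation n lam (transpose_params lam p) (swap_form D)"
  unfolding quad_derivation_def
proof (intro allI impI)
  fix b assume b: "quad_dual n lam (transpose_params lam p) b"
  have "quad_dual n lam (transpose_params lam (transpose_params lam p)) (swap_form b)"
    by (rule quad_dual_transpose[OF param_matrix_transpose[OF p lam] lam b])
  then have "quad_dual n lam p (swap_form b)"
    using quad_dual_cong[of n "transpose_params lam (transpose_params lam p)" p lam "swap_form b"]
      transpose_params_twice[OF p lam] by blast
  then have *: "quad_dual n lam (transpose_params lam p) (swap_form (der_form (idx n) D (swap_form b)))"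
    using D quad_dual_transpose[OF p lam] unfolding quad_derivation_def by blast
  have "swap_form (der_form (idx n) D (swap_form b)) = der_form (idx n) (swap_form D) b"
    unfolding der_form_def swap_form_def
    by (intro ext arg_cong2[of _ _ _ _ "(+)"] sum.reindex_bij_witness[of _ prod.swap prod.swap])
      (auto simp: idx_def)
  with * show "quad_dual n lam (transpose_params lam p) (der_form (idx n) (swap_form D) b)" by simp
qed

lemma quad_derivation_diagonal:
  assumes D: "quad_derivation n lam p D" and p: "param_matrix n p" and lam: "lam \<noteq> 0" "lam \<noteq> 1"
    and n: "n \<ge> 2" and x: "x \<in> idx n" "y \<in> idx n" "x \<noteq> y"
  shows "D x y = 0"
proof -
  obtain i j l m where xy: "x = (i, j)" "y = (l, m)" by (cases x, cases y)
  have s: "{i, l, j, m} \<subseteq> {1..n}" using x xy by (auto simp: idx_def)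
  consider "i = l" "j \<noteq> m" | "i \<noteq> l" "j = m" | "i < l" "j < m" | "i < l" "m < j" | "l < i" "j < m" | "l < i" "m < j"
    using x xy by (cases i l rule: linorder_cases; cases j m rule: linorder_cases) auto
  then show ?thesis
  proof cases
    case 1
    have "swap_form D (j, i) (m, i) = 0"
      by (rule quad_derivation_row[OF quad_derivation_transpose[OF p lam(1) D] param_matrix_transpose[OF p lam(1)] lam(2)])
        (use 1 s n in auto)
    then show ?thesis using 1 by (simp add: xy swap_form_def)
  next
    case 2
    then show ?thesis using quad_derivation_row[OF D p lam(2) _ _ n, of i l j] s by (simp add: xy)
  next
    case 3
    then show ?thesis using quad_derivation_diag[OF D p lam(2), of i l j m] s by (simp add: xy)
  next
    case 4
    then show ?thesis using quad_derivation_anti[OF D p lam(2), of i l m j] s by (simp add: xy insert_commute)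
  next
    case 5
    then show ?thesis using quad_derivation_anti[OF D p lam(2), of l i j m] s by (simp add: xy insert_commute)
  next
    case 6
    then show ?thesis using quad_derivation_diag[OF D p lam(2), of l i m j] s by (simp add: xy insert_commute)
  qed
qed

section \<open>Low degree coefficients\<close>

lemma poly_mapping_single_induct [case_names zero single_add]:
  fixes f :: "'a \<Rightarrow>\<^sub>0 'b::monoid_add"
  assumes "P 0" and "\<And>k v f. k \<notin> Poly_Mapping.keys f \<Longrightarrow> v \<noteq> 0 \<Longrightarrow> P f \<Longrightarrow> P (Poly_Mapping.single k v + f)"
  shows "P f"
proof (induction f rule: update_induct)
  case (update f a b)
  then have "Poly_Mapping.update a b f = Poly_Mapping.single a b + f"
    by (intro poly_mapping_eqI) (auto simp: lookup_update lookup_add lookup_single when_def in_keys_iff)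
  with update assms(2) show ?case by simp
qed (rule assms)

text \<open>A factorization of a word is determined by its cut position, so the convolution is a sum
  over cuts. Both sides are bilinear, hence single monomials suffice.\<close>

lemma lookup_times_fword:
  fixes f g :: "'a fword \<Rightarrow>\<^sub>0 'k::field"
  shows "Poly_Mapping.lookup (f * g) (FWord w) =
    (\<Sum>k\<le>length w. Poly_Mapping.lookup f (FWord (take k w)) * Poly_Mapping.lookup g (FWord (drop k w)))"
proof (induction f rule: poly_mapping_single_induct)
  case zero
  show ?case by simp
next
  case (single_add u c f)
  have "Poly_Mapping.lookup (Poly_Mapping.single u c * g) (FWord w) =
      (\<Sum>k\<le>length w. Poly_Mapping.lookup (Poly_Mapping.single u c) (FWord (take k w)) * Poly_Mapping.lookup g (FWord (drop k w)))"
  proof (induction g rule: poly_mapping_single_induct)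
    case zero
    show ?case by simp
  next
    case (single_add v d g)
    have w: "(c when P) * (d when Q) = (if P \<and> Q then c * d else 0)" for P Q
      by (cases P; cases Q) simp_all
    have "(\<Sum>k\<le>length w. Poly_Mapping.lookup (Poly_Mapping.single u c) (FWord (take k w)) * Poly_Mapping.lookup (Poly_Mapping.single v d) (FWord (drop k w)))
        = (\<Sum>k\<le>length w. if k = length (letters u) then (if FWord w = u + v then c * d else 0) else 0)"
    proof (rule sum.cong[OF refl])
      fix k assume "k \<in> {..length w}"
      then have *: "u = FWord (take k w) \<and> v = FWord (drop k w) \<longleftrightarrow> k = length (letters u) \<and> FWord w = u + v"
        by (cases u; cases v) (auto simp: plus_fword_def append_eq_conv_conj)
      have "Poly_Mapping.lookup (Poly_Mapping.single u c) (FWord (take k w)) * Poly_Mapping.lookup (Poly_Mapping.single v d) (FWord (drop k w)) =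
          (if u = FWord (take k w) \<and> v = FWord (drop k w) then c * d else 0)"
        unfolding lookup_single by (rule w)
      then show "Poly_Mapping.lookup (Poly_Mapping.single u c) (FWord (take k w)) * Poly_Mapping.lookup (Poly_Mapping.single v d) (FWord (drop k w)) =
          (if k = length (letters u) then (if FWord w = u + v then c * d else 0) else 0)"
        unfolding * by simp
    qed
    also have "\<dots> = Poly_Mapping.lookup (Poly_Mapping.single u c * Poly_Mapping.single v d) (FWord w)"
      by (auto simp: mult_single lookup_single when_def plus_fword_def)
    finally show ?case
      using single_add by (simp add: distrib_left lookup_add sum.distrib)
  qed
  with single_add show ?case
    by (simp add: distrib_right lookup_add sum.distrib)
qed

definition const_coeff :: "('a fword \<Rightarrow>\<^sub>0 'k::field) \<Rightarrow> 'k" where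
  "const_coeff f = Poly_Mapping.lookup f (FWord [])"

definition lin_coeff :: "('a fword \<Rightarrow>\<^sub>0 'k::field) \<Rightarrow> 'a \<Rightarrow> 'k" where
  "lin_coeff f a = Poly_Mapping.lookup f (FWord [a])"

definition quad_eval :: "'a set \<Rightarrow> ('a \<Rightarrow> 'a \<Rightarrow> 'k) \<Rightarrow> ('a fword \<Rightarrow>\<^sub>0 'k::field) \<Rightarrow> 'k" where
  "quad_eval S b f = (\<Sum>x\<in>S. \<Sum>y\<in>S. Poly_Mapping.lookup f (FWord [x, y]) * b x y)"

lemma const_coeff_simps [simp]:
  "const_coeff (f * g) = const_coeff f * const_coeff g"
  "const_coeff (f + g) = const_coeff f + const_coeff g"
  "const_coeff (f - g) = const_coeff f - const_coeff g"
  "const_coeff 0 = 0" "const_coeff 1 = 1"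
  "const_coeff (scal c) = c" "const_coeff (gen a) = 0"
  by (simp_all add: const_coeff_def lookup_times_fword lookup_add lookup_minus zero_fword_def
      lookup_one lookup_single gen_def)

lemma lin_coeff_simps [simp]:
  "lin_coeff (f * g) a = const_coeff f * lin_coeff g a + lin_coeff f a * const_coeff g"
  "lin_coeff (f + g) a = lin_coeff f a + lin_coeff g a"
  "lin_coeff (f - g) a = lin_coeff f a - lin_coeff g a"
  "lin_coeff 0 a = 0" "lin_coeff 1 a = 0"
  "lin_coeff (scal c) a = 0" "lin_coeff (gen e) a = (if e = a then 1 else 0)"
  by (simp_all add: lin_coeff_def const_coeff_def lookup_times_fword lookup_add lookup_minus zero_fword_def
      lookup_one lookup_single gen_def when_def)

lemma quad_eval_mult:
  "quad_eval S b (f * g) = const_coeff f * quad_eval S b g +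
    (\<Sum>x\<in>S. \<Sum>y\<in>S. lin_coeff f x * lin_coeff g y * b x y) + quad_eval S b f * const_coeff g"
proof -
  have "Poly_Mapping.lookup (f * g) (FWord [x, y]) * b x y = const_coeff f * (Poly_Mapping.lookup g (FWord [x, y]) * b x y) +
     (lin_coeff f x * lin_coeff g y * b x y) + (Poly_Mapping.lookup f (FWord [x, y]) * b x y) * const_coeff g" for x y
    by (simp add: lookup_times_fword lin_coeff_def const_coeff_def eval_nat_numeral atMost_Suc algebra_simps)
  then show ?thesis
    by (simp only: quad_eval_def sum.distrib sum_distrib_left sum_distrib_right)
qed

lemma quad_eval_simps [simp]:
  "quad_eval S b (f + g) = quad_eval S b f + quad_eval S b g"
  "quad_eval S b (f - g) = quad_eval S b f - quad_eval S b g"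
  "quad_eval S b 0 = 0" "quad_eval S b 1 = 0"
  "quad_eval S b (scal c) = 0" "quad_eval S b (gen e) = 0"
  by (simp_all add: quad_eval_def lookup_add lookup_minus algebra_simps sum.distrib sum_subtractf zero_fword_def
      lookup_one lookup_single gen_def)

lemma quad_eval_scal_mult [simp]: "quad_eval S b (scal c * f) = c * quad_eval S b f"
  by (simp add: quad_eval_mult)

lemma quad_eval_gen_gen [simp]:
  assumes "finite S" "x \<in> S" "y \<in> S"
  shows "quad_eval S b (gen x * gen y) = b x y"
proof -
  have "(if x = u then 1 else 0) * (if y = v then 1 else 0) * b u v
      = (if v = y then if u = x then b x y else 0 else 0)" for u v by simp
  then show ?thesis using assms by (simp add: quad_eval_mult)
qed

section \<open>The defining ideal and its quotient in low degrees\<close>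

abbreviation qmat_free :: "nat \<Rightarrow> ('k::field, (nat \<times> nat) fword \<Rightarrow>\<^sub>0 'k) module" where
  "qmat_free n \<equiv> free_algebra (idx n)"

definition qmat_ideal :: "nat \<Rightarrow> 'k::field \<Rightarrow> (nat \<Rightarrow> nat \<Rightarrow> 'k) \<Rightarrow> ((nat \<times> nat) fword \<Rightarrow>\<^sub>0 'k) set" where
  "qmat_ideal n lam p = Idl\<^bsub>qmat_free n\<^esub> (qmat_relations n lam p)"

lemma free_algebra_simps [simp]:
  "x \<otimes>\<^bsub>free_algebra S\<^esub> y = x * y" "x \<oplus>\<^bsub>free_algebra S\<^esub> y = x + y"
  "\<one>\<^bsub>free_algebra S\<^esub> = 1" "\<zero>\<^bsub>free_algebra S\<^esub> = 0" "c \<odot>\<^bsub>free_algebra S\<^esub> x = scal c * x"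
  by (simp_all add: free_algebra_def)

lemma uminus_in_free_algebra: "f \<in> carrier (free_algebra S) \<Longrightarrow> - f \<in> carrier (free_algebra S)"
  by (simp add: free_algebra_def)

lemma a_inv_free_algebra [simp]:
  assumes "f \<in> carrier (free_algebra S)"
  shows "\<ominus>\<^bsub>free_algebra S\<^esub> f = - f"
proof -
  interpret ring "free_algebra S" by (rule ring_free_algebra)
  show ?thesis
    using minus_equality[OF _ assms uminus_in_free_algebra[OF assms]] by simp
qed

lemma ideal_qmat: "ideal (qmat_ideal n lam p) (qmat_free n)"
  unfolding qmat_ideal_def using qmat_relations_subset[of n lam p]
  by (intro ring.genideal_ideal ring_free_algebra) (simp add: idx_def)

lemma ideal_free_algebraI:
  assumes "I \<subseteq> carrier (free_algebra S)" "0 \<in> I"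
    and "\<And>f g. f \<in> I \<Longrightarrow> g \<in> I \<Longrightarrow> f + g \<in> I"
    and "\<And>f g. f \<in> I \<Longrightarrow> g \<in> carrier (free_algebra S) \<Longrightarrow> g * f \<in> I"
    and "\<And>f g. f \<in> I \<Longrightarrow> g \<in> carrier (free_algebra S) \<Longrightarrow> f * g \<in> I"
  shows "ideal I (free_algebra S)"
proof (rule idealI[OF ring_free_algebra])
  interpret ring "free_algebra S" by (rule ring_free_algebra)
  have "- f \<in> I" if "f \<in> I" for f
    using assms(4)[OF that scal_in_free_algebra[of "-1"]] by (simp add: single_uminus)
  then show "subgroup I (add_monoid (free_algebra S))"
    using assms by (intro add.subgroupI) (auto simp: subset_iff)
qed (use assms in auto)

lemma qmat_relations_cases:
  assumes "r \<in> qmat_relations n lam p"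
  obtains (det) l m i j where "{l, m, i, j} \<subseteq> {1..n}" "i < l" "j < m"
      "r = gen2 l m * gen2 i j - (scal (p l i * p j m) * (gen2 i j * gen2 l m)
                         + scal ((lam - 1) * p l i) * (gen2 i m * gen2 l j))"
    | (anti) l m i j where "{l, m, i, j} \<subseteq> {1..n}" "i < l" "m \<le> j"
      "r = gen2 l m * gen2 i j - scal (lam * p l i * p j m) * (gen2 i j * gen2 l m)"
    | (row) m i j where "{m, i, j} \<subseteq> {1..n}" "j < m"
      "r = gen2 i m * gen2 i j - scal (p j m) * (gen2 i j * gen2 i m)"
  using assms unfolding qmat_relations_def
proof (elim UnE CollectE exE conjE)
  fix l m i j
  assume "r = gen2 l m * gen2 i j - scal (p j m) * (gen2 i j * gen2 l m)" "{l, m, i, j} \<subseteq> {1..n}" "l = i" "m > j"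
  then show thesis by (intro row[of m i j]) simp_all
qed (rule det anti; assumption)+

text \<open>The elements satisfying all three conditions form an ideal: without constant and linear
  terms, multiplication changes the quadratic part only by the constant of the other factor. This
  ideal contains the relations, hence everything they generate.\<close>

lemma qmat_ideal_low_degree:
  assumes f: "f \<in> qmat_ideal n lam p"
  shows "const_coeff f = 0" "lin_coeff f a = 0"
    "quad_dual n lam p b \<Longrightarrow> quad_eval (idx n) b f = 0"
proof -
  let ?J = "{f \<in> carrier (qmat_free n). const_coeff f = 0 \<and> (\<forall>a. lin_coeff f a = 0) \<and>
    (\<forall>b. quad_dual n lam p b \<longrightarrow> quad_eval (idx n) b f = 0)}"
  have "ideal ?J (qmat_free n)"
    by (rule ideal_free_algebraI)
      (auto simp: add_in_free_algebra mult_in_free_algebra quad_eval_mult simp del: split_paired_All,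
        simp add: free_algebra_def)
  moreover have "qmat_relations n lam p \<subseteq> ?J"
  proof
    fix r assume r: "r \<in> qmat_relations n lam p"
    have "r \<in> carrier (qmat_free n)"
      using r qmat_relations_subset unfolding idx_def by blast
    moreover have "const_coeff r = 0 \<and> (\<forall>a. lin_coeff r a = 0)"
      using r unfolding qmat_relations_def by auto
    moreover have "quad_eval (idx n) b r = 0" if b: "quad_dual n lam p b" for b
    proof -
      have *: "quad_eval (idx n) b (gen2 i j * gen2 l m) = b (i, j) (l, m)" 
        if "{l, m, i, j} \<subseteq> {1..n}" for i j l m
        using that by (intro quad_eval_gen_gen) (auto simp: idx_def)
      from r show ?thesis
      proof (cases rule: qmat_relations_cases)
        case (det l m i j)
        then show ?thesis using quad_dual_detD[OF b, of i l j m] by (simp add: *)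
      next
        case (anti l m i j)
        then have "b (l, m) (i, j) = lam * p l i * p j m * b (i, j) (l, m)" 
          using b unfolding quad_dual_def by (meson insert_subset)
        then show ?thesis using anti by (simp add: *)
      next
        case (row m i j)
        then show ?thesis using quad_dual_rowD[OF b, of i j m] by (simp add: *)
      qed
    qed
    ultimately show "r \<in> ?J" by blast
  qed
  ultimately have "qmat_ideal n lam p \<subseteq> ?J"
    unfolding qmat_ideal_def by (intro ring.genideal_minimal ring_free_algebra)
  with f show "const_coeff f = 0" "lin_coeff f a = 0"
    "quad_dual n lam p b \<Longrightarrow> quad_eval (idx n) b f = 0" by blast+
qed

lemma qmat_coset_eq_iff:
  assumes "f \<in> carrier (qmat_free n)" "g \<in> carrier (qmat_free n)"
  shows "qmat_ideal n lam p +>\<^bsub>qmat_free n\<^esub> f = qmat_ideal n lam p +>\<^bsub>qmat_free n\<^esub> g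
    \<longleftrightarrow> f - g \<in> qmat_ideal n lam p"
  using ring.quotient_eq_iff_same_a_r_cos[OF ring_free_algebra ideal_qmat assms, of lam p] assms
  by (simp add: a_minus_def)

lemma qmat_algebra_eq:
  "qmat_algebra n lam p = quot_algebra (qmat_free n) (qmat_ideal n lam p)"
  by (simp add: qmat_algebra_def qmat_ideal_def idx_def Let_def)

lemma qmat_coset_ops:
  fixes lam n and p :: "nat \<Rightarrow> nat \<Rightarrow> 'k::field"
  defines "A \<equiv> qmat_algebra n lam p" and "C \<equiv> \<lambda>f. qmat_ideal n lam p +>\<^bsub>qmat_free n\<^esub> f"
  assumes f: "f \<in> carrier (qmat_free n)"
  shows "C f \<in> carrier A" "\<one>\<^bsub>A\<^esub> = C 1" "c \<odot>\<^bsub>A\<^esub> C f = C (scal c * f)"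
    "g \<in> carrier (qmat_free n) \<Longrightarrow> C f \<oplus>\<^bsub>A\<^esub> C g = C (f + g)"
    "g \<in> carrier (qmat_free n) \<Longrightarrow> C f \<otimes>\<^bsub>A\<^esub> C g = C (f * g)"
proof -
  interpret ideal "qmat_ideal n lam p" "qmat_free n" by (rule ideal_qmat)
  show "C f \<in> carrier A" 
    using ring_hom_memE(1)[OF rcos_ring_hom f] by (simp add: A_def C_def qmat_algebra_eq)
  show "\<one>\<^bsub>A\<^esub> = C 1"
    using ring_hom_memE(4)[OF rcos_ring_hom] by (simp add: A_def C_def qmat_algebra_eq)
  show "c \<odot>\<^bsub>A\<^esub> C f = C (scal c * f)"
    unfolding A_def C_def qmat_algebra_eq
    using smult_quot_free_algebra[OF ideal_qmat f] by simp
  show "C f \<oplus>\<^bsub>A\<^esub> C g = C (f + g)" "C f \<otimes>\<^bsub>A\<^esub> C g = C (f * g)" if "g \<in> carrier (qmat_free n)"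
    using ring_hom_memE(2,3)[OF rcos_ring_hom f that] by (simp_all add: A_def C_def qmat_algebra_eq)
qed

lemma qmat_carrier_elim:
  assumes "U \<in> carrier (qmat_algebra n lam p)"
  obtains f where "f \<in> carrier (qmat_free n)" "U = qmat_ideal n lam p +>\<^bsub>qmat_free n\<^esub> f"
  using assms by (auto simp: qmat_algebra_eq FactRing_def A_RCOSETS_def')

section \<open>Linear algebra and lifts of algebra homomorphisms\<close>

lemma sum_fun_apply: "(\<Sum>x\<in>A. f x) y = (\<Sum>x\<in>A. f x y)"
  by (induction A rule: infinite_finite_induct) auto

text \<open>In matrix terms \<open>N L = 1\<close>. The rows of \<open>L\<close> span all functions
  on \<open>B\<close>, which bounds \<open>card B\<close>. If the cardinalities agree, these rows
  are a basis; since \<open>(L N - 1) L = 0\<close>, independence gives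
  \<open>L N = 1\<close>.\<close>

lemma left_inverse_family:
  fixes N :: "'b \<Rightarrow> 'a \<Rightarrow> 'k::field" and L :: "'a \<Rightarrow> 'b \<Rightarrow> 'k"
  assumes A: "finite A" and B: "finite B"
    and NL: "\<And>b c. b \<in> B \<Longrightarrow> c \<in> B \<Longrightarrow> (\<Sum>x\<in>A. N b x * L x c) = (if b = c then 1 else 0)"
  shows "card B \<le> card A"
    and "card A = card B \<Longrightarrow> x \<in> A \<Longrightarrow> y \<in> A \<Longrightarrow> (\<Sum>b\<in>B. L x b * N b y) = (if x = y then 1 else 0)"
proof -
  interpret vector_space "\<lambda>(c::'k) f (x::'b). c * f x"
    by unfold_locales (auto simp: fun_eq_iff algebra_simps)
  define e :: "'b \<Rightarrow> 'b \<Rightarrow> 'k" where "e b = (\<lambda>x. if x = b then 1 else 0)" for b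
  \<comment> \<open>Rows are cut off to zero outside \<open>B\<close>, where the hypothesis says
    nothing.\<close>
  define r where "r x = (\<lambda>b. if b \<in> B then L x b else 0)" for x
  have inj_e: "inj_on e B" by (auto simp: inj_on_def e_def fun_eq_iff split: if_splits)
  have indep_e: "independent (e ` B)"
  proof (rule independent_if_scalars_zero)
    fix f x assume f: "(\<Sum>x\<in>e ` B. (\<lambda>xa. f x * x xa)) = 0" and "x \<in> e ` B"
    then obtain b where b: "b \<in> B" "x = e b" by blast
    have "0 = (\<Sum>c\<in>B. f (e c) * e c b)"
      using arg_cong[OF f, of "\<lambda>g. g b"] inj_e by (simp add: sum_fun_apply sum.reindex)
    also have "\<dots> = (\<Sum>c\<in>B. if c = b then f (e b) else 0)"
      by (intro sum.cong) (auto simp: e_def)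
    finally show "f x = 0" using b B by simp
  qed (use B in simp)
  have e_span: "e ` B \<subseteq> span (r ` A)"
  proof clarify
    fix b assume b: "b \<in> B"
    have "e b = (\<Sum>x\<in>A. (\<lambda>c. N b x * r x c))"
    proof
      fix c show "e b c = (\<Sum>x\<in>A. (\<lambda>c. N b x * r x c)) c"
        using NL[OF b, of c] b by (cases "c \<in> B") (auto simp: sum_fun_apply e_def r_def)
    qed
    also have "\<dots> \<in> span (r ` A)"
      by (intro span_sum span_scale span_base) auto
    finally show "e b \<in> span (r ` A)" .
  qed
  have le: "card B \<le> card P" if "finite P" "e ` B \<subseteq> span P" for P
    using independent_span_bound[OF that(1) indep_e that(2)] card_image[OF inj_e] by simp
  show "card B \<le> card A"
    using le[OF _ e_span] A card_image_le[OF A, of r] by simp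
  assume eq: "card A = card B" and x: "x \<in> A" and y: "y \<in> A"
  have card_r: "card (r ` A) = card A"
    using le[OF _ e_span] A card_image_le[OF A, of r] eq by simp
  then have inj_r: "inj_on r A" using A by (simp add: eq_card_imp_inj_on)
  have indep_r: "independent (r ` A)"
  proof
    assume "dependent (r ` A)"
    then obtain v where v: "v \<in> r ` A" "v \<in> span (r ` A - {v})" unfolding dependent_def by blast
    then have "span (r ` A) = span (r ` A - {v})"
      using span_redundant[OF v(2)] by (simp add: insert_absorb)
    then have "card B \<le> card (r ` A - {v})" using le[of "r ` A - {v}"] e_span A by simp
    then show False using v(1) A card_r eq card_gt_0_iff[of "r ` A"] by auto
  qed
  \<comment> \<open>Row \<open>x\<close> of \<open>L N - 1\<close>.\<close>
  define w where "w z = (\<Sum>b\<in>B. L x b * N b z) - (if x = z then 1 else 0)" for z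
  have "(\<Sum>v\<in>r ` A. (\<lambda>c. w (inv_into A r v) * v c)) = 0"
  proof
    fix c
    have "(\<Sum>v\<in>r ` A. (\<lambda>c. w (inv_into A r v) * v c)) c = (\<Sum>z\<in>A. w z * r z c)"
      using inj_r by (simp add: sum_fun_apply sum.reindex)
    also have "\<dots> = 0"
    proof (cases "c \<in> B")
      case True
      have "(\<Sum>z\<in>A. w z * r z c) = (\<Sum>z\<in>A. \<Sum>b\<in>B. L x b * (N b z * L z c)) - (\<Sum>z\<in>A. if z = x then L x c else 0)"
        unfolding sum_subtractf[symmetric]
        by (intro sum.cong) (auto simp: w_def r_def True algebra_simps sum_distrib_left)
      also have "(\<Sum>z\<in>A. \<Sum>b\<in>B. L x b * (N b z * L z c)) = (\<Sum>b\<in>B. L x b * (\<Sum>z\<in>A. N b z * L z c))"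
        by (subst sum.swap) (simp add: sum_distrib_left)
      also have "\<dots> = (\<Sum>b\<in>B. if b = c then L x c else 0)"
        using NL True by (intro sum.cong) auto
      finally show ?thesis using True A B x by simp
    qed (simp add: r_def)
    finally show "(\<Sum>v\<in>r ` A. (\<lambda>c. w (inv_into A r v) * v c)) c = 0 c" by simp
  qed
  from independentD[OF indep_r _ _ this, of "r y"] have "w y = 0"
    using A y inj_r by simp
  then show "(\<Sum>b\<in>B. L x b * N b y) = (if x = y then 1 else 0)" by (simp add: w_def)
qed

definition qmat_eqv where
  "qmat_eqv n lam p f g \<longleftrightarrow>
    f \<in> carrier (qmat_free n) \<and> g \<in> carrier (qmat_free n) \<and> f - g \<in> qmat_ideal n lam p"

lemma qmat_eqv_low_degree:
  assumes "qmat_eqv n lam p f g"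
  shows "const_coeff f = const_coeff g" "lin_coeff f a = lin_coeff g a"
    "quad_dual n lam p b \<Longrightarrow> quad_eval (idx n) b f = quad_eval (idx n) b g"
  using assms qmat_ideal_low_degree[of "f - g" n lam p] by (auto simp: qmat_eqv_def)

text \<open>A homomorphism of the quotients is represented by a choice \<open>H\<close> of preimages in the free
  algebra, which is multiplicative and linear modulo the ideal only.\<close>

locale qmat_lift =
  fixes n m :: nat and lam mu :: "'k::field" and p q :: "nat \<Rightarrow> nat \<Rightarrow> 'k"
    and H :: "((nat \<times> nat) fword \<Rightarrow>\<^sub>0 'k) \<Rightarrow> ((nat \<times> nat) fword \<Rightarrow>\<^sub>0 'k)"
  assumes H_closed: "f \<in> carrier (qmat_free n) \<Longrightarrow> H f \<in> carrier (qmat_free m)"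
    and H_one: "qmat_eqv m mu q (H 1) 1"
    and H_add: "f \<in> carrier (qmat_free n) \<Longrightarrow> g \<in> carrier (qmat_free n) \<Longrightarrow>
      qmat_eqv m mu q (H (f + g)) (H f + H g)"
    and H_mult: "f \<in> carrier (qmat_free n) \<Longrightarrow> g \<in> carrier (qmat_free n) \<Longrightarrow>
      qmat_eqv m mu q (H (f * g)) (H f * H g)"
    and H_scal: "f \<in> carrier (qmat_free n) \<Longrightarrow> qmat_eqv m mu q (H (scal c * f)) (scal c * H f)"
    and H_eqv: "qmat_eqv n lam p f g \<Longrightarrow> qmat_eqv m mu q (H f) (H g)"

lemma one_in_free_algebra: "1 \<in> carrier (free_algebra S)"
  using scal_in_free_algebra[of 1] by simp

lemma alg_hom_lift:
  fixes lam mu :: "'k::field" and p q :: "nat \<Rightarrow> nat \<Rightarrow> 'k"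
  assumes h: "h \<in> ring_hom (qmat_algebra n lam p) (qmat_algebra m mu q)"
    and lin: "\<And>c U. U \<in> carrier (qmat_algebra n lam p) \<Longrightarrow>
      h (c \<odot>\<^bsub>qmat_algebra n lam p\<^esub> U) = c \<odot>\<^bsub>qmat_algebra m mu q\<^esub> h U"
  obtains H where "qmat_lift n m lam mu p q H"
    "\<And>f. f \<in> carrier (qmat_free n) \<Longrightarrow>
      h (qmat_ideal n lam p +>\<^bsub>qmat_free n\<^esub> f) = qmat_ideal m mu q +>\<^bsub>qmat_free m\<^esub> H f"
proof -
  let ?A = "qmat_algebra n lam p" and ?B = "qmat_algebra m mu q"
  define C where "C f = qmat_ideal n lam p +>\<^bsub>qmat_free n\<^esub> f" for f
  define D where "D f = qmat_ideal m mu q +>\<^bsub>qmat_free m\<^esub> f" for f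
  note opsC = qmat_coset_ops[where n = n and lam = lam and p = p, folded C_def]
  note opsD = qmat_coset_ops[where n = m and lam = mu and p = q, folded D_def]
  note h_mem = ring_hom_memE[OF h]
  have "\<exists>g. g \<in> carrier (qmat_free m) \<and> h (C f) = D g" if "f \<in> carrier (qmat_free n)" for f
    using qmat_carrier_elim[OF h_mem(1)[OF opsC(1)[OF that]]] unfolding D_def by metis
  then obtain H where H: "H f \<in> carrier (qmat_free m)" "h (C f) = D (H f)"
    if "f \<in> carrier (qmat_free n)" for f by metis
  have eqvC: "qmat_eqv n lam p f g \<longleftrightarrow> f \<in> carrier (qmat_free n) \<and> g \<in> carrier (qmat_free n) \<and> C f = C g" for f g
    using qmat_coset_eq_iff[of f n g lam p] by (auto simp: qmat_eqv_def C_def)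
  have eqvD: "qmat_eqv m mu q f g \<longleftrightarrow> f \<in> carrier (qmat_free m) \<and> g \<in> carrier (qmat_free m) \<and> D f = D g" for f g
    using qmat_coset_eq_iff[of f m g mu q] by (auto simp: qmat_eqv_def D_def)
  note cl = add_in_free_algebra mult_in_free_algebra scal_in_free_algebra one_in_free_algebra
  have "qmat_lift n m lam mu p q H"
  proof
    show "qmat_eqv m mu q (H 1) 1"
      using H[OF one_in_free_algebra] h_mem(4) opsC(2)[OF one_in_free_algebra] opsD(2)[OF one_in_free_algebra]
      by (simp add: eqvD cl)
    show "qmat_eqv m mu q (H (f + g)) (H f + H g)" if "f \<in> carrier (qmat_free n)" "g \<in> carrier (qmat_free n)" for f g
      using that h_mem(3)[OF opsC(1)[OF that(1)] opsC(1)[OF that(2)]] by (simp add: eqvD cl H opsC opsD)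
    show "qmat_eqv m mu q (H (f * g)) (H f * H g)" if "f \<in> carrier (qmat_free n)" "g \<in> carrier (qmat_free n)" for f g
      using that h_mem(2)[OF opsC(1)[OF that(1)] opsC(1)[OF that(2)]] by (simp add: eqvD cl H opsC opsD)
    show "qmat_eqv m mu q (H (scal c * f)) (scal c * H f)" if "f \<in> carrier (qmat_free n)" for f c
      using that lin[OF opsC(1)[OF that], of c] by (simp add: eqvD cl H opsC opsD)
    show "qmat_eqv m mu q (H f) (H g)" if "qmat_eqv n lam p f g" for f g
      using that H[of f] H[of g] by (simp add: eqvC eqvD)
  qed (rule H)
  then show thesis using that H(2) unfolding C_def D_def by blast
qed

locale qmat_lift_pair =
  H: qmat_lift n m lam mu p q H + K: qmat_lift m n mu lam q p K
  for n m :: nat and lam mu :: "'k::field" and p q :: "nat \<Rightarrow> nat \<Rightarrow> 'k" and H K +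
  assumes KH: "f \<in> carrier (qmat_free n) \<Longrightarrow> qmat_eqv n lam p (K (H f)) f"
    and HK: "g \<in> carrier (qmat_free m) \<Longrightarrow> qmat_eqv m mu q (H (K g)) g"

lemma alg_iso_lift:
  fixes lam mu :: "'k::field" and p q :: "nat \<Rightarrow> nat \<Rightarrow> 'k"
  assumes "is_algebra_iso (qmat_algebra n lam p) (qmat_algebra m mu q)"
  obtains H K where "qmat_lift_pair n m lam mu p q H K"
proof -
  let ?A = "qmat_algebra n lam p" and ?B = "qmat_algebra m mu q"
  from assms obtain h where h: "h \<in> ring_iso ?A ?B"
    and lin: "\<And>c U. U \<in> carrier ?A \<Longrightarrow> h (c \<odot>\<^bsub>?A\<^esub> U) = c \<odot>\<^bsub>?B\<^esub> h U"
    unfolding is_algebra_iso_def algebra_iso_def by blast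
  define k where "k = inv_into (carrier ?A) h"
  have k: "k \<in> ring_iso ?B ?A"
    unfolding k_def by (rule ring_iso_set_sym[OF ring_qmat_algebra h])
  have bij: "bij_betw h (carrier ?A) (carrier ?B)" using h by (rule ring_iso_memE)
  have hk: "h (k V) = V" "k V \<in> carrier ?A" if "V \<in> carrier ?B" for V
    using bij that unfolding k_def by (auto simp: bij_betw_def f_inv_into_f inv_into_into)
  have kh: "k (h U) = U" "h U \<in> carrier ?B" if "U \<in> carrier ?A" for U
    using bij that unfolding k_def by (auto simp: bij_betw_def)
  have smult_closed: "c \<odot>\<^bsub>?A\<^esub> U \<in> carrier ?A" if "U \<in> carrier ?A" for c U
    using that by (elim qmat_carrier_elim)
      (simp add: qmat_coset_ops mult_in_free_algebra scal_in_free_algebra)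
  have lin': "k (c \<odot>\<^bsub>?B\<^esub> V) = c \<odot>\<^bsub>?A\<^esub> k V" if "V \<in> carrier ?B" for c V
    using lin[OF hk(2)[OF that], of c] kh(1)[OF smult_closed[OF hk(2)[OF that]], of c] hk(1)[OF that] by simp
  obtain H where H: "qmat_lift n m lam mu p q H" 
    "\<And>f. f \<in> carrier (qmat_free n) \<Longrightarrow>
      h (qmat_ideal n lam p +>\<^bsub>qmat_free n\<^esub> f) = qmat_ideal m mu q +>\<^bsub>qmat_free m\<^esub> H f"
    using alg_hom_lift[OF _ lin] h unfolding ring_iso_def by blast
  obtain K where K: "qmat_lift m n mu lam q p K" 
    "\<And>f. f \<in> carrier (qmat_free m) \<Longrightarrow>
      k (qmat_ideal m mu q +>\<^bsub>qmat_free m\<^esub> f) = qmat_ideal n lam p +>\<^bsub>qmat_free n\<^esub> K f"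
    using alg_hom_lift[OF _ lin'] k unfolding ring_iso_def by blast
  interpret H: qmat_lift n m lam mu p q H by (rule H)
  interpret K: qmat_lift m n mu lam q p K by (rule K)
  have "qmat_lift_pair n m lam mu p q H K"
  proof
    show "qmat_eqv n lam p (K (H f)) f" if "f \<in> carrier (qmat_free n)" for f
      using that kh(1)[OF qmat_coset_ops(1)[OF that]] H(2)[OF that] K(2)[OF H.H_closed[OF that]]
      by (simp add: qmat_eqv_def H.H_closed K.H_closed flip: qmat_coset_eq_iff)
    show "qmat_eqv m mu q (H (K g)) g" if "g \<in> carrier (qmat_free m)" for g
      using that hk(1)[OF qmat_coset_ops(1)[OF that]] K(2)[OF that] H(2)[OF K.H_closed[OF that]]
      by (simp add: qmat_eqv_def H.H_closed K.H_closed flip: qmat_coset_eq_iff)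
  qed
  then show thesis by (rule that)
qed

section \<open>Linear parts of isomorphisms\<close>

lemma free_algebra_induct [consumes 1, case_names scal add gen_mult]:
  assumes f: "f \<in> carrier (free_algebra S)"
    and scal: "\<And>c. P (scal c)"
    and add: "\<And>f g. f \<in> carrier (free_algebra S) \<Longrightarrow> g \<in> carrier (free_algebra S) \<Longrightarrow> P f \<Longrightarrow> P g \<Longrightarrow> P (f + g)"
    and gen_mult: "\<And>x f. x \<in> S \<Longrightarrow> f \<in> carrier (free_algebra S) \<Longrightarrow> P f \<Longrightarrow> P (gen x * f)"
  shows "P (f :: 'a fword \<Rightarrow>\<^sub>0 'k::field)"
proof -
  have word: "P (Poly_Mapping.single (FWord w) c)" if "set w \<subseteq> S" for w c
    using that
  proof (induction w)
    case Nil
    then show ?case using scal[of c] by (simp add: zero_fword_def)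
  next
    case (Cons x w)
    have "Poly_Mapping.single (FWord (x # w)) c = gen x * Poly_Mapping.single (FWord w) c"
      by (simp add: gen_def mult_single plus_fword_def)
    moreover have "Poly_Mapping.single (FWord w) c \<in> carrier (free_algebra S)"
      using Cons by (simp add: free_algebra_def)
    ultimately show ?case using Cons by (simp add: gen_mult)
  qed
  show ?thesis
    using f
  proof (induction f rule: poly_mapping_single_induct)
    case zero
    then show ?case using scal[of 0] by simp
  next
    case (single_add u c f)
    have "Poly_Mapping.keys (Poly_Mapping.single u c + f) = insert u (Poly_Mapping.keys f)"
      using single_add by (auto simp: in_keys_iff lookup_add lookup_single when_def split: if_splits)
    then have "set (letters u) \<subseteq> S" "f \<in> carrier (free_algebra S)"
      using single_add(4) by (auto simp: free_algebra_def)
    moreover from this have "Poly_Mapping.single u c \<in> carrier (free_algebra S)"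
      by (simp add: free_algebra_def)
    ultimately show ?case
      using word[of "letters u" c] single_add by (intro add) simp_all
  qed
qed

lemma quad_dual_form_cong:
  assumes "quad_dual n lam p b" "\<And>x y. x \<in> idx n \<Longrightarrow> y \<in> idx n \<Longrightarrow> b x y = b' x y"
  shows "quad_dual n lam p b'"
  using assms unfolding quad_dual_def idx_def by simp

lemma gen_in_qmat_free [simp]: "x \<in> idx n \<Longrightarrow> gen x \<in> carrier (qmat_free n)"
  by (rule gen_in_free_algebra)

lemma qmat_relations_eqv:
  assumes "{l, m, i, j} \<subseteq> {1..n}"
  shows "i < l \<Longrightarrow> j < m \<Longrightarrow> qmat_eqv n lam p (gen2 l m * gen2 i j)
      (scal (p l i * p j m) * (gen2 i j * gen2 l m) + scal ((lam - 1) * p l i) * (gen2 i m * gen2 l j))"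
    and "i < l \<Longrightarrow> m \<le> j \<Longrightarrow> qmat_eqv n lam p (gen2 l m * gen2 i j)
      (scal (lam * p l i * p j m) * (gen2 i j * gen2 l m))"
    and "j < m \<Longrightarrow> qmat_eqv n lam p (gen2 i m * gen2 i j) (scal (p j m) * (gen2 i j * gen2 i m))"
proof -
  have I: "r \<in> qmat_ideal n lam p" if "r \<in> qmat_relations n lam p" for r
    using that ring.genideal_self[OF ring_free_algebra qmat_relations_subset[of n lam p]]
    unfolding qmat_ideal_def idx_def by blast
  have ij: "(l, m) \<in> idx n" "(i, j) \<in> idx n" "(i, m) \<in> idx n" "(l, j) \<in> idx n"
    using assms by (auto simp: idx_def)
  note cl = mult_in_free_algebra add_in_free_algebra scal_in_free_algebra gen_in_qmat_free ij
  show "qmat_eqv n lam p (gen2 l m * gen2 i j)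
      (scal (p l i * p j m) * (gen2 i j * gen2 l m) + scal ((lam - 1) * p l i) * (gen2 i m * gen2 l j))"
    if "i < l" "j < m"
    unfolding qmat_eqv_def
    by (intro conjI cl I) (use assms that in \<open>unfold qmat_relations_def, blast\<close>)
  show "qmat_eqv n lam p (gen2 l m * gen2 i j) (scal (lam * p l i * p j m) * (gen2 i j * gen2 l m))"
    if "i < l" "m \<le> j"
    unfolding qmat_eqv_def
    by (intro conjI cl I) (use assms that in \<open>unfold qmat_relations_def, blast\<close>)
  show "qmat_eqv n lam p (gen2 i m * gen2 i j) (scal (p j m) * (gen2 i j * gen2 i m))"
    if "j < m"
    unfolding qmat_eqv_def
    by (intro conjI cl I) (use assms that in \<open>unfold qmat_relations_def, blast\<close>)
qed

context qmat_lift
begin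

lemma H_const:
  assumes "f \<in> carrier (qmat_free n)" "g \<in> carrier (qmat_free n)"
  shows "const_coeff (H (f + g)) = const_coeff (H f) + const_coeff (H g)"
    "const_coeff (H (f * g)) = const_coeff (H f) * const_coeff (H g)"
  using qmat_eqv_low_degree(1)[OF H_add[OF assms]] qmat_eqv_low_degree(1)[OF H_mult[OF assms]] by simp_all

lemma H_lin:
  assumes "f \<in> carrier (qmat_free n)" "g \<in> carrier (qmat_free n)"
  shows "lin_coeff (H (f + g)) a = lin_coeff (H f) a + lin_coeff (H g) a"
    "lin_coeff (H (f * g)) a = const_coeff (H f) * lin_coeff (H g) a + lin_coeff (H f) a * const_coeff (H g)"
  using qmat_eqv_low_degree(2)[OF H_add[OF assms]] qmat_eqv_low_degree(2)[OF H_mult[OF assms]] by simp_all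

lemma H_scal_low: "const_coeff (H (scal c)) = c" "lin_coeff (H (scal c)) a = 0"
proof -
  have *: "qmat_eqv m mu q (H (scal c)) (scal c * H 1)"
    using H_scal[OF one_in_free_algebra, of c] by simp
  show "const_coeff (H (scal c)) = c" "lin_coeff (H (scal c)) a = 0"
    using qmat_eqv_low_degree(1)[OF H_one] qmat_eqv_low_degree(2)[OF H_one]
      qmat_eqv_low_degree(1)[OF *] qmat_eqv_low_degree(2)[OF *] by simp_all
qed

text \<open>A linear \<open>T\<close> that is constant on congruence classes can be applied to the
  image of each relation under \<open>H\<close>. It is used once for a coordinate of the linear
  part, to kill constants, and once for a quadratic form, to pull it back.\<close>

lemma quad_dual_pullback_functional:
  assumes T_add: "\<And>f g. T (f + g) = T f + T g" and T_scal: "\<And>c f. T (scal c * f) = c * T f"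
    and T_eqv: "\<And>f g. qmat_eqv m mu q f g \<Longrightarrow> T f = T g"
  shows "quad_dual n lam p (\<lambda>x y. T (H (gen x) * H (gen y)))"
proof -
  have mult: "T (H (gen x * gen y)) = T (H (gen x) * H (gen y))" if "x \<in> idx n" "y \<in> idx n" for x y
    using that by (intro T_eqv H_mult) auto
  have scal: "T (H (scal c * f)) = c * T (H f)" if "f \<in> carrier (qmat_free n)" for c f
    using T_eqv[OF H_scal[OF that]] by (simp add: T_scal)
  have add: "T (H (f + g)) = T (H f) + T (H g)" if "f \<in> carrier (qmat_free n)" "g \<in> carrier (qmat_free n)" for f g
    using T_eqv[OF H_add[OF that]] by (simp add: T_add)
  note eval = add scal mult mult_in_free_algebra scal_in_free_algebra
  show ?thesis
    unfolding quad_dual_def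
  proof (intro ballI conjI impI)
    fix l s i j assume ij: "l \<in> {1..n}" "s \<in> {1..n}" "i \<in> {1..n}" "j \<in> {1..n}"
    then have sub: "{l, s, i, j} \<subseteq> {1..n}"
      and idx: "(l, s) \<in> idx n" "(i, j) \<in> idx n" "(i, s) \<in> idx n" "(l, j) \<in> idx n"
      by (auto simp: idx_def)
    show "T (H (gen2 l s) * H (gen2 i j)) = p l i * p j s * T (H (gen2 i j) * H (gen2 l s)) +
        (lam - 1) * p l i * T (H (gen2 i s) * H (gen2 l j))" if "i < l \<and> j < s"
      using T_eqv[OF H_eqv[OF qmat_relations_eqv(1)[OF sub]]] that by (simp add: eval idx)
    show "T (H (gen2 l s) * H (gen2 i j)) = lam * p l i * p j s * T (H (gen2 i j) * H (gen2 l s))"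
      if "i < l \<and> s \<le> j"
      using T_eqv[OF H_eqv[OF qmat_relations_eqv(2)[OF sub]]] that by (simp add: eval idx)
    show "T (H (gen2 l s) * H (gen2 i j)) = p j s * T (H (gen2 i j) * H (gen2 l s))"
      if "l = i \<and> j < s"
      using T_eqv[OF H_eqv[OF qmat_relations_eqv(3)[OF sub]]] that idx by (simp add: eval)
  qed
qed

text \<open>The linear part of \<open>H\<close> obeys a product rule twisted by the constants of
  \<open>H\<close>. The generators thus determine it up to linear combination, even while the
  constants may still be nonzero.\<close>

lemma lin_coeff_in_span:
  assumes "f \<in> carrier (qmat_free n)"
  shows "\<exists>k. \<forall>a. lin_coeff (H f) a = (\<Sum>x\<in>idx n. k x * lin_coeff (H (gen x)) a)"
  using assms
proof (induction rule: free_algebra_induct)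
  case (scal c)
  show ?case by (rule exI[of _ "\<lambda>_. 0"]) (simp add: H_scal_low)
next
  case (add f g)
  then obtain k k' where "\<forall>a. lin_coeff (H f) a = (\<Sum>x\<in>idx n. k x * lin_coeff (H (gen x)) a)"
    "\<forall>a. lin_coeff (H g) a = (\<Sum>x\<in>idx n. k' x * lin_coeff (H (gen x)) a)" by blast
  then show ?case
    using add by (intro exI[of _ "\<lambda>x. k x + k' x"]) (simp add: H_lin distrib_right sum.distrib)
next
  case (gen_mult y f)
  then obtain k where k: "lin_coeff (H f) a = (\<Sum>x\<in>idx n. k x * lin_coeff (H (gen x)) a)" for a by blast
  let ?c = "const_coeff (H (gen y))"
  have "(\<Sum>x\<in>idx n. (?c * k x + (if x = y then const_coeff (H f) else 0)) * lin_coeff (H (gen x)) a)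
    = (\<Sum>x\<in>idx n. ?c * (k x * lin_coeff (H (gen x)) a) +
      (if x = y then lin_coeff (H (gen y)) a * const_coeff (H f) else 0))" for a
    by (intro sum.cong) (auto simp: algebra_simps)
  then have *: "\<forall>a. lin_coeff (H (gen y * f)) a =
    (\<Sum>x\<in>idx n. (?c * k x + (if x = y then const_coeff (H f) else 0)) * lin_coeff (H (gen x)) a)"
    using gen_mult(1,2) k by (simp add: H_lin sum.distrib sum_distrib_left del: split_paired_All)
  show ?case by (rule exI, rule *)
qed

end

section \<open>Invertibility of the linear part and vanishing of the constants\<close>

locale qmat_iso_lift = qmat_lift_pair n m lam mu p q H K
  for n m :: nat and lam mu :: "'k::field" and p q H K +
  assumes n2: "n \<ge> 2" and m2: "m \<ge> 2" and lam: "lam \<noteq> 0" "lam \<noteq> 1" and mu: "mu \<noteq> 0" "mu \<noteq> 1"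
    and p: "param_matrix n p" and q: "param_matrix m q"
begin

lemma flip: "qmat_iso_lift m n mu lam q p K H"
  by unfold_locales (fact HK KH n2 m2 lam mu p q)+

text \<open>Modulo the ideal, \<open>gen a\<close> is \<open>H (K (gen a))\<close>, whose linear
  part lies in the span of the linear parts of the \<open>H (gen x)\<close>.\<close>

lemma left_inverse_exists:
  obtains N where "\<And>a b. a \<in> idx m \<Longrightarrow> b \<in> idx m \<Longrightarrow>
    (\<Sum>x\<in>idx n. N a x * lin_coeff (H (gen x)) b) = (if a = b then 1 else 0)"
proof -
  have "\<exists>k. \<forall>b. lin_coeff (gen a) b = (\<Sum>x\<in>idx n. k x * lin_coeff (H (gen x)) b)" if "a \<in> idx m" for a
    using H.lin_coeff_in_span[OF K.H_closed[OF gen_in_qmat_free[OF that]]]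
      qmat_eqv_low_degree(2)[OF HK[OF gen_in_qmat_free[OF that]]] by simp
  then obtain N where "\<And>a b. a \<in> idx m \<Longrightarrow> lin_coeff (gen a) b = (\<Sum>x\<in>idx n. N a x * lin_coeff (H (gen x)) b)"
    by metis
  then show thesis by (intro that[of N]) (metis lin_coeff_simps(7))
qed

lemma size_le: "m \<le> n"
proof -
  obtain N where "\<And>a b. a \<in> idx m \<Longrightarrow> b \<in> idx m \<Longrightarrow>
    (\<Sum>x\<in>idx n. N a x * lin_coeff (H (gen x)) b) = (if a = b then 1 else 0)"
    using left_inverse_exists by blast
  from left_inverse_family(1)[OF finite_idx finite_idx this] have "m * m \<le> n * n"
    by (simp add: idx_def)
  then show ?thesis by (metis not_le zero_le mult_strict_mono')
qed

lemma size_eq: "n = m"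
  using size_le qmat_iso_lift.size_le[OF flip] by simp

text \<open>Pulls back the coordinate functional given by column \<open>y\<close> of the inverse
  \<open>N\<close>. It takes the linear part of \<open>H (gen x)\<close> to 1 for
  \<open>x = y\<close> and to 0 otherwise, so the product rule leaves only constants in the
  form.\<close>

lemma quad_dual_const:
  assumes y: "y \<in> idx n"
  shows "quad_dual n lam p (\<lambda>u v. const_coeff (H (gen u)) * (if v = y then 1 else 0) +
    (if u = y then 1 else 0) * const_coeff (H (gen v)))"
proof -
  let ?L = "\<lambda>x. lin_coeff (H (gen x))" and ?c = "\<lambda>x. const_coeff (H (gen x))"
  obtain N where N: "\<And>a b. a \<in> idx m \<Longrightarrow> b \<in> idx m \<Longrightarrow>
    (\<Sum>x\<in>idx n. N a x * ?L x b) = (if a = b then 1 else 0)"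
    using left_inverse_exists by blast
  have LN: "(\<Sum>b\<in>idx m. ?L x b * N b y) = (if x = y then 1 else 0)" if "x \<in> idx n" for x
    using left_inverse_family(2)[OF finite_idx finite_idx N _ that y] size_eq by simp
  have "quad_dual n lam p (\<lambda>u v. \<Sum>b\<in>idx m. lin_coeff (H (gen u) * H (gen v)) b * N b y)"
  proof (rule H.quad_dual_pullback_functional)
    show "(\<Sum>b\<in>idx m. lin_coeff f b * N b y) = (\<Sum>b\<in>idx m. lin_coeff g b * N b y)"
      if "qmat_eqv m mu q f g" for f g
      by (simp only: qmat_eqv_low_degree(2)[OF that])
  qed (auto simp: distrib_right sum.distrib sum_distrib_left mult.assoc)
  moreover have "(\<Sum>b\<in>idx m. lin_coeff (H (gen u) * H (gen v)) b * N b y) =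
     ?c u * (if v = y then 1 else 0) + (if u = y then 1 else 0) * ?c v" if "u \<in> idx n" "v \<in> idx n" for u v
  proof -
    have "(\<Sum>b\<in>idx m. lin_coeff (H (gen u) * H (gen v)) b * N b y) =
        ?c u * (\<Sum>b\<in>idx m. ?L v b * N b y) + (\<Sum>b\<in>idx m. ?L u b * N b y) * ?c v"
      by (simp add: algebra_simps sum.distrib sum_distrib_left sum_distrib_right)
    then show ?thesis using LN[OF that(1)] LN[OF that(2)] by simp
  qed
  ultimately show ?thesis
    by (rule quad_dual_form_cong)
qed

text \<open>On a minor, the three term relation applied to the form of one antidiagonal generator
  kills the constant of the other one. Only the corners \<open>(1, 1)\<close> and
  \<open>(n, n)\<close> lie on no antidiagonal. There a row and a column relation give
  \<open>d = P * d\<close> and \<open>d = lam * R * d\<close> with \<open>P * R = 1\<close>,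
  impossible for \<open>d \<noteq> 0\<close> as \<open>lam \<noteq> 1\<close>.\<close>

lemma const_zero:
  assumes x: "x \<in> idx n"
  shows "const_coeff (H (gen x)) = 0"
proof -
  let ?c = "\<lambda>x. const_coeff (H (gen x))"
  have anti: "?c (i, j) = 0" "?c (l, k) = 0" if "{i, l, j, k} \<subseteq> {1..n}" "i < l" "k < j" for i j l k
  proof -
    have idx: "(i, j) \<in> idx n" "(l, k) \<in> idx n" using that by (auto simp: idx_def)
    have "p l i \<noteq> 0" using param_matrix_nz[OF p] that by blast
    then show "?c (i, j) = 0" "?c (l, k) = 0"
      using quad_dual_detD[OF quad_dual_const[OF idx(1)], of i l k j]
        quad_dual_detD[OF quad_dual_const[OF idx(2)], of i l k j] that lam by auto
  qed
  have corner: "d = 0" if "d = P * d" "d = lam * R * d" "P * R = 1" for P R d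
  proof (rule ccontr)
    assume "d \<noteq> 0"
    with that have "P = 1" "lam * R = 1" by auto
    with that(3) lam show False by simp
  qed
  have first: "?c (1, 1) = 0"
  proof (rule corner[of _ "p 1 2" "p 2 1"])
    have idx: "(1, 2) \<in> idx n" "(2, 1) \<in> idx n" using n2 by (auto simp: idx_def)
    show "?c (1, 1) = p 1 2 * ?c (1, 1)"
      using quad_dual_rowD[OF quad_dual_const[OF idx(1)], of 1 1 2] n2 by simp
    show "?c (1, 1) = lam * p 2 1 * ?c (1, 1)"
      using quad_dual_colD[OF quad_dual_const[OF idx(2)] _ _ p, of 1 2 1] n2 by simp
  qed (use param_matrix_inv[OF p] n2 in simp)
  obtain k where k: "n = Suc k" "1 \<le> k" using n2 by (cases n) auto
  have last: "?c (n, n) = 0"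
  proof (rule corner[of _ "p k n" "p n k"])
    have idx: "(n, k) \<in> idx n" "(k, n) \<in> idx n" using k by (auto simp: idx_def)
    show "?c (n, n) = p k n * ?c (n, n)"
      using quad_dual_rowD[OF quad_dual_const[OF idx(1)], of n k n] k by simp
    show "?c (n, n) = lam * p n k * ?c (n, n)"
      using quad_dual_colD[OF quad_dual_const[OF idx(2)] _ _ p, of k n n] k by simp
  qed (use param_matrix_inv[OF p] k in simp)
  obtain i j where ij: "x = (i, j)" "i \<in> {1..n}" "j \<in> {1..n}" using x by (auto simp: idx_def)
  consider "i < n" "1 < j" | "1 < i" "j < n" | "i = 1" "j = 1" | "i = n" "j = n"
    using ij n2 by fastforce
  then show ?thesis
  proof cases
    case 1
    show ?thesis unfolding ij(1) by (rule anti(1)[of i n j 1]) (use 1 ij in auto)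
  next
    case 2
    show ?thesis unfolding ij(1) by (rule anti(2)[of 1 i n j]) (use 2 ij in auto)
  qed (use first last ij in auto)
qed

lemma const_coeff_H:
  assumes "f \<in> carrier (qmat_free n)"
  shows "const_coeff (H f) = const_coeff f"
  using assms by (induction rule: free_algebra_induct) (simp_all add: H.H_scal_low H.H_const const_zero)

lemma lin_coeff_H:
  assumes "f \<in> carrier (qmat_free n)"
  shows "lin_coeff (H f) a = (\<Sum>x\<in>idx n. lin_coeff f x * lin_coeff (H (gen x)) a)"
  using assms
proof (induction rule: free_algebra_induct)
  case (gen_mult y f)
  have "(\<Sum>x\<in>idx n. (if y = x then 1 else 0) * const_coeff f * lin_coeff (H (gen x)) a) =
      (\<Sum>x\<in>idx n. if y = x then const_coeff f * lin_coeff (H (gen y)) a else 0)"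
    by (intro sum.cong) auto
  then show ?case using gen_mult by (simp add: H.H_lin const_zero const_coeff_H)
qed (simp_all add: H.H_scal_low H.H_lin distrib_right sum.distrib)

definition fwd :: "nat \<times> nat \<Rightarrow> nat \<times> nat \<Rightarrow> 'k" where
  "fwd x a = lin_coeff (H (gen x)) a"

definition bwd :: "nat \<times> nat \<Rightarrow> nat \<times> nat \<Rightarrow> 'k" where
  "bwd a x = lin_coeff (K (gen a)) x"

lemma bwd_fwd:
  assumes "a \<in> idx m" "b \<in> idx m"
  shows "(\<Sum>x\<in>idx n. bwd a x * fwd x b) = (if a = b then 1 else 0)"
  using lin_coeff_H[OF K.H_closed, of "gen a" b] qmat_eqv_low_degree(2)[OF HK, of "gen a" b] assms
  by (simp add: fwd_def bwd_def)

lemma fwd_bwd: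
  assumes "x \<in> idx n" "y \<in> idx n"
  shows "(\<Sum>a\<in>idx m. fwd x a * bwd a y) = (if x = y then 1 else 0)"
  using left_inverse_family(2)[OF finite_idx finite_idx bwd_fwd _ assms] size_eq by simp

end

section \<open>Transport of forms and weight derivations along the linear part\<close>

definition pull_form :: "'j set \<Rightarrow> ('i \<Rightarrow> 'j \<Rightarrow> 'k) \<Rightarrow> ('i \<Rightarrow> 'j \<Rightarrow> 'k) \<Rightarrow> ('j \<Rightarrow> 'j \<Rightarrow> 'k) \<Rightarrow> 'i \<Rightarrow> 'i \<Rightarrow> 'k::field" where
  "pull_form S X Y b x y = (\<Sum>u\<in>S. \<Sum>v\<in>S. X x u * Y y v * b u v)"

text \<open>Composition is a matrix product in each slot. The slots carry separate matrices because
  the product rule puts the weight on one slot at a time.\<close>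

lemma pull_form_pull_form:
  "pull_form T X Y (pull_form S Z W b) =
    pull_form S (\<lambda>x u. \<Sum>a\<in>T. X x a * Z a u) (\<lambda>y v. \<Sum>c\<in>T. Y y c * W c v) b"
proof (intro ext)
  fix x y
  have "pull_form T X Y (pull_form S Z W b) x y =
      (\<Sum>a\<in>T. \<Sum>c\<in>T. \<Sum>u\<in>S. \<Sum>v\<in>S. X x a * Z a u * (Y y c * W c v) * b u v)"
    by (simp add: pull_form_def sum_distrib_left mult_ac)
  also have "\<dots> = (\<Sum>a\<in>T. \<Sum>u\<in>S. \<Sum>c\<in>T. \<Sum>v\<in>S. X x a * Z a u * (Y y c * W c v) * b u v)"
    by (intro sum.cong refl sum.swap)
  also have "\<dots> = (\<Sum>u\<in>S. \<Sum>a\<in>T. \<Sum>c\<in>T. \<Sum>v\<in>S. X x a * Z a u * (Y y c * W c v) * b u v)"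
    by (rule sum.swap)
  also have "\<dots> = (\<Sum>u\<in>S. \<Sum>a\<in>T. \<Sum>v\<in>S. \<Sum>c\<in>T. X x a * Z a u * (Y y c * W c v) * b u v)"
    by (intro sum.cong refl sum.swap)
  also have "\<dots> = (\<Sum>u\<in>S. \<Sum>v\<in>S. \<Sum>a\<in>T. \<Sum>c\<in>T. X x a * Z a u * (Y y c * W c v) * b u v)"
    by (intro sum.cong refl sum.swap)
  also have "\<dots> = pull_form S (\<lambda>x u. \<Sum>a\<in>T. X x a * Z a u) (\<lambda>y v. \<Sum>c\<in>T. Y y c * W c v) b x y"
    by (simp only: pull_form_def sum_product[symmetric] sum_distrib_right[symmetric])
  finally show "pull_form T X Y (pull_form S Z W b) x y =
      pull_form S (\<lambda>x u. \<Sum>a\<in>T. X x a * Z a u) (\<lambda>y v. \<Sum>c\<in>T. Y y c * W c v) b x y" .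
qed

text \<open>All monomials of a relation have the same row indices and the same column indices with
  multiplicity, hence the same total weight.\<close>

lemma quad_dual_weight:
  fixes al be :: "nat \<Rightarrow> 'k::field"
  assumes b: "quad_dual n lam p b"
  defines "h \<equiv> \<lambda>x. al (fst x) + be (snd x)"
  shows "quad_dual n lam p (\<lambda>x y. (h x + h y) * b x y)"
proof -
  have "h (l, m) + h (i, j) = h (i, j) + h (l, m)" "h (i, m) + h (l, j) = h (i, j) + h (l, m)" for i j l m
    by (simp_all add: h_def)
  then show ?thesis
    using b unfolding quad_dual_def by (simp add: distrib_left mult.left_commute)
qed

context qmat_iso_lift
begin

lemma quad_dual_pull:
  assumes b: "quad_dual m mu q b"
  shows "quad_dual n lam p (pull_form (idx m) fwd fwd b)"
proof (rule quad_dual_form_cong)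
  show "quad_dual n lam p (\<lambda>x y. quad_eval (idx m) b (H (gen x) * H (gen y)))"
    by (rule H.quad_dual_pullback_functional) (use b in \<open>auto dest: qmat_eqv_low_degree(3)\<close>)
  \<comment> \<open>As the constants vanish, only the product of the two linear parts contributes in
    degree two.\<close>
  show "quad_eval (idx m) b (H (gen x) * H (gen y)) = pull_form (idx m) fwd fwd b x y"
    if "x \<in> idx n" "y \<in> idx n" for x y
    using that by (simp add: quad_eval_mult const_zero pull_form_def fwd_def)
qed

lemma quad_dual_push:
  assumes "quad_dual n lam p b"
  shows "quad_dual m mu q (pull_form (idx n) bwd bwd b)"
proof -
  have "qmat_iso_lift.fwd K = bwd"
    by (intro ext) (simp add: qmat_iso_lift.fwd_def[OF flip] bwd_def)
  then show ?thesis
    using qmat_iso_lift.quad_dual_pull[OF flip assms] by simp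
qed

text \<open>The matrix is the diagonal weight conjugated by the linear part. Pulling a form back,
  weighting it and pushing it forward again acts on one slot by this matrix and on the other by
  \<open>bwd fwd = 1\<close>, and the sum over the two slots is \<open>der_form\<close>.\<close>

lemma transported_derivation:
  fixes al be :: "nat \<Rightarrow> 'k"
  defines "h \<equiv> \<lambda>x. al (fst x) + be (snd x)"
  shows "quad_derivation m mu q (\<lambda>a b. \<Sum>x\<in>idx n. bwd a x * (h x * fwd x b))"
  unfolding quad_derivation_def
proof (intro allI impI)
  fix b assume b: "quad_dual m mu q b"
  let ?D = "\<lambda>a b. \<Sum>x\<in>idx n. bwd a x * (h x * fwd x b)"
  let ?I = "\<lambda>a b. \<Sum>x\<in>idx n. bwd a x * fwd x b"
  let ?hL = "\<lambda>x b. h x * fwd x b"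
  let ?b = "\<lambda>x y. (h x + h y) * pull_form (idx m) fwd fwd b x y"
  have b_eq: "?b = (\<lambda>x y. pull_form (idx m) ?hL fwd b x y + pull_form (idx m) fwd ?hL b x y)"
    by (intro ext) (simp add: pull_form_def distrib_right distrib_left sum_distrib_left sum.distrib mult_ac)
  have "quad_dual n lam p ?b"
    unfolding h_def by (rule quad_dual_weight[OF quad_dual_pull[OF b]])
  then have "quad_dual m mu q (pull_form (idx n) bwd bwd ?b)"
    by (rule quad_dual_push)
  moreover have "pull_form (idx n) bwd bwd ?b a c = der_form (idx m) ?D b a c"
    if a: "a \<in> idx m" and c: "c \<in> idx m" for a c
  proof -
    have "pull_form (idx n) bwd bwd ?b a c =
       pull_form (idx n) bwd bwd (pull_form (idx m) ?hL fwd b) a c +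
       pull_form (idx n) bwd bwd (pull_form (idx m) fwd ?hL b) a c"
      unfolding b_eq by (simp add: pull_form_def distrib_left sum.distrib)
    also have "\<dots> = pull_form (idx m) ?D ?I b a c + pull_form (idx m) ?I ?D b a c"
      unfolding pull_form_pull_form ..
    also have "pull_form (idx m) ?D ?I b a c = (\<Sum>u\<in>idx m. \<Sum>v\<in>idx m. if v = c then ?D a u * b u c else 0)"
      unfolding pull_form_def using bwd_fwd[OF c] by (intro sum.cong refl) auto
    also have "\<dots> = (\<Sum>u\<in>idx m. ?D a u * b u c)"
      using c by simp
    also have "pull_form (idx m) ?I ?D b a c = (\<Sum>u\<in>idx m. if u = a then \<Sum>v\<in>idx m. ?D c v * b a v else 0)"
      unfolding pull_form_def using bwd_fwd[OF a] by (intro sum.cong refl) auto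
    also have "\<dots> = (\<Sum>v\<in>idx m. ?D c v * b a v)"
      using a by simp
    finally show ?thesis by (simp add: der_form_def)
  qed
  ultimately show "quad_dual m mu q (der_form (idx m) ?D b)"
    by (rule quad_dual_form_cong)
qed

text \<open>The conjugated weight \<open>?D\<close> is diagonal, so \<open>h fwd = fwd ?D\<close>:
  column \<open>a\<close> of \<open>fwd\<close> is an eigenvector of the weight for
  \<open>?D a a\<close>, and each of its nonzero entries sits at a generator of that weight.\<close>

lemma fwd_same_weight:
  fixes al be :: "nat \<Rightarrow> 'k"
  defines "h \<equiv> \<lambda>x. al (fst x) + be (snd x)"
  assumes x: "x \<in> idx n" "y \<in> idx n" and a: "a \<in> idx m" "fwd x a \<noteq> 0" "fwd y a \<noteq> 0"
  shows "h x = h y"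
proof -
  let ?D = "\<lambda>a b. \<Sum>x\<in>idx n. bwd a x * (h x * fwd x b)"
  have D: "?D c a = 0" if "c \<in> idx m" "c \<noteq> a" for c
    unfolding h_def
    by (rule quad_derivation_diagonal[OF transported_derivation q mu m2 that(1) a(1) that(2)])
  have "h z * fwd z a = fwd z a * ?D a a" if z: "z \<in> idx n" for z
  proof -
    have "h z * fwd z a = (\<Sum>x\<in>idx n. if z = x then h z * fwd z a else 0)"
      using z by simp
    also have "\<dots> = (\<Sum>x\<in>idx n. (\<Sum>c\<in>idx m. fwd z c * bwd c x) * (h x * fwd x a))"
      using fwd_bwd[OF z] by (intro sum.cong) auto
    also have "\<dots> = (\<Sum>x\<in>idx n. \<Sum>c\<in>idx m. fwd z c * (bwd c x * (h x * fwd x a)))"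
      by (simp add: sum_distrib_right mult.assoc)
    also have "\<dots> = (\<Sum>c\<in>idx m. fwd z c * ?D c a)"
      by (subst sum.swap) (simp add: sum_distrib_left)
    also have "\<dots> = (\<Sum>c\<in>idx m. if c = a then fwd z a * ?D a a else 0)"
      using D by (intro sum.cong) auto
    also have "\<dots> = fwd z a * ?D a a" using a(1) by simp
    finally show ?thesis .
  qed
  from this[OF x(1)] this[OF x(2)] a(2,3) show ?thesis by (simp add: mult.commute)
qed

text \<open>The indicator weight of a row determines the first index, that of a column the
  second.\<close>

lemma fwd_inj:
  assumes x: "x \<in> idx n" "y \<in> idx n" and a: "a \<in> idx m" "fwd x a \<noteq> 0" "fwd y a \<noteq> 0"
  shows "x = y"
proof -
  have "fst x = fst y"
    using fwd_same_weight[OF x a, of "\<lambda>i. if i = fst x then 1 else 0" "\<lambda>_. 0"] by (simp split: if_splits)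
  moreover have "snd x = snd y"
    using fwd_same_weight[OF x a, of "\<lambda>_. 0" "\<lambda>i. if i = snd x then 1 else 0"] by (simp split: if_splits)
  ultimately show ?thesis by (simp add: prod_eq_iff)
qed

text \<open>Invertibility leaves a nonzero entry in every row of \<open>fwd\<close>, and by
  \<open>fwd_inj\<close> each column has at most one. Choosing these entries gives an injection of a
  finite set into itself, and every other entry is zero.\<close>

lemma monomial:
  obtains s t where "bij_betw s (idx n) (idx n)" "\<And>x. x \<in> idx n \<Longrightarrow> t x \<noteq> 0"
    "\<And>b. quad_dual n mu q b \<Longrightarrow> quad_dual n lam p (\<lambda>x y. t x * t y * b (s x) (s y))"
proof -
  have "\<exists>a\<in>idx m. fwd x a \<noteq> 0" if "x \<in> idx n" for x
  proof (rule ccontr)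
    assume "\<not> (\<exists>a\<in>idx m. fwd x a \<noteq> 0)"
    then show False using fwd_bwd[OF that that] by simp
  qed
  then obtain s where s: "\<And>x. x \<in> idx n \<Longrightarrow> s x \<in> idx n" "\<And>x. x \<in> idx n \<Longrightarrow> fwd x (s x) \<noteq> 0"
    unfolding size_eq by metis
  have "inj_on s (idx n)"
    using fwd_inj s size_eq by (intro inj_onI) metis
  then have bij: "bij_betw s (idx n) (idx n)"
    using s(1) by (simp add: bij_betw_def endo_inj_surj image_subset_iff)
  have zero: "fwd x a = 0" if x: "x \<in> idx n" "a \<in> idx m" "a \<noteq> s x" for x a
  proof (rule ccontr)
    assume *: "fwd x a \<noteq> 0"
    obtain y where y: "y \<in> idx n" "a = s y"
      using bij x(2) unfolding size_eq[symmetric] bij_betw_def by blast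
    then show False using fwd_inj[OF x(1) y(1) x(2) *] s(2)[OF y(1)] x(3) by simp
  qed
  show thesis
  proof (rule that[OF bij s(2)])
    fix b assume "quad_dual n mu q b"
    then have "quad_dual n lam p (pull_form (idx m) fwd fwd b)"
      using quad_dual_pull size_eq by simp
    then show "quad_dual n lam p (\<lambda>x y. fwd x (s x) * fwd y (s y) * b (s x) (s y))"
    proof (rule quad_dual_form_cong)
      fix x y assume x: "x \<in> idx n" and y: "y \<in> idx n"
      have sx: "s x \<in> idx m" "s y \<in> idx m" using s(1)[OF x] s(1)[OF y] by (simp_all add: size_eq)
      have "(\<Sum>v\<in>idx m. fwd x u * fwd y v * b u v) =
          (if u = s x then fwd x (s x) * fwd y (s y) * b (s x) (s y) else 0)" if "u \<in> idx m" for u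
      proof -
        have "(\<Sum>v\<in>idx m. fwd x u * fwd y v * b u v) =
            (\<Sum>v\<in>idx m. if v = s y then fwd x u * fwd y (s y) * b u (s y) else 0)"
          by (rule sum.cong) (use zero[OF y] in \<open>auto simp del: split_paired_All\<close>)
        then show ?thesis using zero[OF x that] sx by auto
      qed
      then show "pull_form (idx m) fwd fwd b x y = fwd x (s x) * fwd y (s y) * b (s x) (s y)"
        using sx by (simp add: pull_form_def)
    qed
  qed
qed

end

section \<open>Permutations preserving minors\<close>

text \<open>Counting up from 1 gives \<open>k \<le> f k\<close>, counting down from \<open>n\<close>
  gives the converse.\<close>

lemma strict_mono_endo_id:
  fixes f :: "nat \<Rightarrow> nat"
  assumes range: "\<And>i. i \<in> {1..n} \<Longrightarrow> f i \<in> {1..n}"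
    and mono: "\<And>i l. i \<in> {1..n} \<Longrightarrow> l \<in> {1..n} \<Longrightarrow> i < l \<Longrightarrow> f i < f l"
    and i: "i \<in> {1..n}"
  shows "f i = i"
proof (rule antisym)
  have ge: "k \<in> {1..n} \<Longrightarrow> k \<le> f k" for k
  proof (induction k)
    case (Suc k)
    show ?case
    proof (cases "k = 0")
      case False
      then show ?thesis using Suc mono[of k "Suc k"] by auto
    qed (use range[of 1] Suc in auto)
  qed simp
  show "i \<le> f i" using ge i .
  have "k < n \<Longrightarrow> f (n - k) \<le> n - k" for k
  proof (induction k)
    case 0
    then show ?case using range[of n] by auto
  next
    case (Suc k)
    then have "f (n - Suc k) < f (n - k)" by (intro mono) auto
    then show ?case using Suc by simp
  qed
  from this[of "n - i"] i show "f i \<le> i" by auto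
qed

text \<open>By \<open>rect\<close> the directions of the sides of a minor determine each other.
  Adjacent minors share sides, so the direction at \<open>start\<close> spreads over the grid and
  makes \<open>f\<close> increase along columns and \<open>g\<close> along rows.\<close>

lemma grid_id:
  fixes f g :: "nat \<Rightarrow> nat \<Rightarrow> nat"
  assumes n: "n \<ge> 2"
    and range: "\<And>i j. i \<in> {1..n} \<Longrightarrow> j \<in> {1..n} \<Longrightarrow> f i j \<in> {1..n} \<and> g i j \<in> {1..n}"
    and rect: "\<And>i l j m. {i, l, j, m} \<subseteq> {1..n} \<Longrightarrow> i < l \<Longrightarrow> j < m \<Longrightarrow>
      (f i j < f l j \<longleftrightarrow> f i m < f l m) \<and> (f i j < f l j \<longleftrightarrow> g i j < g i m) \<and> (f i j < f l j \<longleftrightarrow> g l j < g l m)"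
    and start: "f 1 1 < f n 1"
    and ij: "i \<in> {1..n}" "j \<in> {1..n}"
  shows "f i j = i \<and> g i j = j"
proof -
  have "g 1 1 < g 1 n" using rect[of 1 n 1 n] start n by auto
  then have "f 1 1 < f l 1" if "1 < l" "l \<le> n" for l
    using rect[of 1 l 1 n] that n by auto
  then have g1: "g l 1 < g l n" if "1 \<le> l" "l \<le> n" for l
    using rect[of 1 l 1 n] that n \<open>g 1 1 < g 1 n\<close> by (cases "l = 1") auto
  have f1: "f i 1 < f l 1" if "1 \<le> i" "i < l" "l \<le> n" for i l
    using rect[of i l 1 n] that n g1[of i] by auto
  have f: "f i j < f l j" if "1 \<le> i" "i < l" "l \<le> n" "1 \<le> j" "j \<le> n" for i l j
    using rect[of i l 1 j] that n f1[of i l] by (cases "j = 1") auto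
  have g: "g i j < g i m" if "1 \<le> i" "i \<le> n" "1 \<le> j" "j < m" "m \<le> n" for i j m
    using rect[of i n j m] rect[of 1 n j m] f[of i n j] f[of 1 n j] that n by (cases "i = n") auto
  have "f i j = i"
    by (rule strict_mono_endo_id[of n "\<lambda>i. f i j"]) (use range f ij in auto)
  moreover have "g i j = j"
    by (rule strict_mono_endo_id[of n "\<lambda>j. g i j"]) (use range g ij in auto)
  ultimately show ?thesis by simp
qed

text \<open>Of the eight symmetries of a square, four preserve each of its diagonals. The images of
  \<open>(1, 1)\<close> and \<open>(n, 1)\<close> show which one occurs on the outer minor.
  Exchanging the coordinates or reflecting them by \<open>n + 1 - _\<close> reduces each case to
  \<open>grid_id\<close>.\<close>

lemma rectangle_map_cases:
  fixes s :: "nat \<times> nat \<Rightarrow> nat \<times> nat"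
  assumes n: "n \<ge> 2" and s: "\<And>x. x \<in> idx n \<Longrightarrow> s x \<in> idx n"
    and rect: "\<And>i l j m. {i, l, j, m} \<subseteq> {1..n} \<Longrightarrow> i < l \<Longrightarrow> j < m \<Longrightarrow>
      \<exists>i' l' j' m'. i' < l' \<and> j' < m' \<and> {s (i, m), s (l, j)} = {(i', m'), (l', j')} \<and>
        {s (i, j), s (l, m)} = {(i', j'), (l', m')}"
  obtains (id) "\<And>i j. i \<in> {1..n} \<Longrightarrow> j \<in> {1..n} \<Longrightarrow> s (i, j) = (i, j)"
    | (transpose) "\<And>i j. i \<in> {1..n} \<Longrightarrow> j \<in> {1..n} \<Longrightarrow> s (i, j) = (j, i)"
    | (rotate) "\<And>i j. i \<in> {1..n} \<Longrightarrow> j \<in> {1..n} \<Longrightarrow> s (i, j) = (n + 1 - i, n + 1 - j)"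
    | (antitranspose) "\<And>i j. i \<in> {1..n} \<Longrightarrow> j \<in> {1..n} \<Longrightarrow> s (i, j) = (n + 1 - j, n + 1 - i)"
proof -
  define f g where "f i j = fst (s (i, j))" and "g i j = snd (s (i, j))" for i j
  have fg: "s (i, j) = (f i j, g i j)" for i j by (simp add: f_def g_def)
  have range: "1 \<le> f i j \<and> f i j \<le> n \<and> 1 \<le> g i j \<and> g i j \<le> n" if "i \<in> {1..n}" "j \<in> {1..n}" for i j
    using s[of "(i, j)"] that by (auto simp: idx_def fg)
  have range': "n + 1 - f i j \<in> {1..n}" "n + 1 - g i j \<in> {1..n}" if "i \<in> {1..n}" "j \<in> {1..n}" for i j
    using range[OF that] by auto
  \<comment> \<open>The alternatives describe, in this order, the behaviour of the identity, the
    rotation, the transposition and the antitransposition on one minor.\<close>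
  have types: "(f i j = f i m \<and> f l j = f l m \<and> g i j = g l j \<and> g i m = g l m \<and> f i j < f l j \<and> g i j < g i m) \<or>
      (f i j = f i m \<and> f l j = f l m \<and> g i j = g l j \<and> g i m = g l m \<and> f l j < f i j \<and> g i m < g i j) \<or>
      (g i j = g i m \<and> g l j = g l m \<and> f i j = f l j \<and> f i m = f l m \<and> g i j < g l j \<and> f i j < f i m) \<or>
      (g i j = g i m \<and> g l j = g l m \<and> f i j = f l j \<and> f i m = f l m \<and> g l j < g i j \<and> f i m < f i j)"
    if "{i, l, j, m} \<subseteq> {1..n}" "i < l" "j < m" for i l j m
  proof -
    from rect[OF that] obtain i' l' j' m' where *: "i' < l'" "j' < m'"
      "(f i m = i' \<and> g i m = m') \<and> f l j = l' \<and> g l j = j' \<or> (f i m = l' \<and> g i m = j') \<and> f l j = i' \<and> g l j = m'"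
      "(f i j = i' \<and> g i j = j') \<and> f l m = l' \<and> g l m = m' \<or> (f i j = l' \<and> g i j = m') \<and> f l m = i' \<and> g l m = j'"
      unfolding fg doubleton_eq_iff prod.inject by blast
    from *(3,4) show ?thesis by (elim disjE conjE) (simp_all add: *(1,2))
  qed
  have mem: "i \<in> {1..n}" "l \<in> {1..n}" "j \<in> {1..n}" "m \<in> {1..n}" if "{i, l, j, m} \<subseteq> {1..n}" for i l j m
    using that by auto
  have rev: "n + 1 - a < n + 1 - b \<longleftrightarrow> b < a" if "a \<le> n" for a b :: nat using that by auto
  have "f 1 1 < f n 1 \<or> f n 1 < f 1 1 \<or> g 1 1 < g n 1 \<or> g n 1 < g 1 1"
    using types[of 1 n 1 n] n by auto
  then show thesis
  proof (elim disjE)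
    assume start: "f 1 1 < f n 1"
    have "f i j = i \<and> g i j = j" if ij: "i \<in> {1..n}" "j \<in> {1..n}" for i j
    proof (rule grid_id[of n f g, OF n _ _ _ ij])
      fix i l j m :: nat
      assume *: "{i, l, j, m} \<subseteq> {1..n}" "i < l" "j < m"
      show "(f i j < f l j \<longleftrightarrow> f i m < f l m) \<and>
          (f i j < f l j \<longleftrightarrow> g i j < g i m) \<and> (f i j < f l j \<longleftrightarrow> g l j < g l m)"
        using types[OF *] by (elim disjE conjE) auto
    qed (use range start in simp_all)
    then show thesis by (intro id) (simp add: fg)
  next
    assume start: "g 1 1 < g n 1"
    have "g i j = i \<and> f i j = j" if ij: "i \<in> {1..n}" "j \<in> {1..n}" for i j
    proof (rule grid_id[of n g f, OF n _ _ _ ij])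
      fix i l j m :: nat
      assume *: "{i, l, j, m} \<subseteq> {1..n}" "i < l" "j < m"
      show "(g i j < g l j \<longleftrightarrow> g i m < g l m) \<and>
          (g i j < g l j \<longleftrightarrow> f i j < f i m) \<and> (g i j < g l j \<longleftrightarrow> f l j < f l m)"
        using types[OF *] by (elim disjE conjE) auto
    qed (use range start in simp_all)
    then show thesis by (intro transpose) (simp add: fg)
  next
    assume start: "f n 1 < f 1 1"
    have "n + 1 - f i j = i \<and> n + 1 - g i j = j" if ij: "i \<in> {1..n}" "j \<in> {1..n}" for i j
    proof (rule grid_id[of n "\<lambda>i j. n + 1 - f i j" "\<lambda>i j. n + 1 - g i j", OF n _ _ _ ij])
      fix i l j m :: nat
      assume *: "{i, l, j, m} \<subseteq> {1..n}" "i < l" "j < m"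
      have "f i j \<le> n" "f i m \<le> n" "g i j \<le> n" "g l j \<le> n" 
        using range mem[OF *(1)] by blast+
      then show "(n + 1 - f i j < n + 1 - f l j \<longleftrightarrow> n + 1 - f i m < n + 1 - f l m) \<and>
          (n + 1 - f i j < n + 1 - f l j \<longleftrightarrow> n + 1 - g i j < n + 1 - g i m) \<and>
          (n + 1 - f i j < n + 1 - f l j \<longleftrightarrow> n + 1 - g l j < n + 1 - g l m)"
        using types[OF *] by (simp only: rev) (elim disjE conjE, auto)
    next
      show "n + 1 - f i j \<in> {1..n} \<and> n + 1 - g i j \<in> {1..n}" if "i \<in> {1..n}" "j \<in> {1..n}" for i j
        using range'[OF that] by blast
      show "n + 1 - f 1 1 < n + 1 - f n 1" using range[of 1 1] start n by auto
    qed
    then have "f i j = n + 1 - i \<and> g i j = n + 1 - j" if "i \<in> {1..n}" "j \<in> {1..n}" for i j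
      using range[OF that] that by (metis diff_diff_cancel trans_le_add1)
    then show thesis by (intro rotate) (simp add: fg)
  next
    assume start: "g n 1 < g 1 1"
    have "n + 1 - g i j = i \<and> n + 1 - f i j = j" if ij: "i \<in> {1..n}" "j \<in> {1..n}" for i j
    proof (rule grid_id[of n "\<lambda>i j. n + 1 - g i j" "\<lambda>i j. n + 1 - f i j", OF n _ _ _ ij])
      fix i l j m :: nat
      assume *: "{i, l, j, m} \<subseteq> {1..n}" "i < l" "j < m"
      have "g i j \<le> n" "g i m \<le> n" "f i j \<le> n" "f l j \<le> n" 
        using range mem[OF *(1)] by blast+
      then show "(n + 1 - g i j < n + 1 - g l j \<longleftrightarrow> n + 1 - g i m < n + 1 - g l m) \<and>
          (n + 1 - g i j < n + 1 - g l j \<longleftrightarrow> n + 1 - f i j < n + 1 - f i m) \<and>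
          (n + 1 - g i j < n + 1 - g l j \<longleftrightarrow> n + 1 - f l j < n + 1 - f l m)"
        using types[OF *] by (simp only: rev) (elim disjE conjE, auto)
    next
      show "n + 1 - g i j \<in> {1..n} \<and> n + 1 - f i j \<in> {1..n}" if "i \<in> {1..n}" "j \<in> {1..n}" for i j
        using range'[OF that] by blast
      show "n + 1 - g 1 1 < n + 1 - g n 1" using range[of 1 1] start n by auto
    qed
    then have "g i j = n + 1 - i \<and> f i j = n + 1 - j" if "i \<in> {1..n}" "j \<in> {1..n}" for i j
      using range[OF that] that by (metis diff_diff_cancel trans_le_add1)
    then show thesis by (intro antitranspose) (simp add: fg)
  qed
qed

section \<open>Parameters related by a monomial isomorphism\<close>

locale monomial_iso =
  fixes n :: nat and lam mu :: "'k::field" and p q :: "nat \<Rightarrow> nat \<Rightarrow> 'k"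
    and s :: "nat \<times> nat \<Rightarrow> nat \<times> nat" and t :: "nat \<times> nat \<Rightarrow> 'k"
  assumes n2: "n \<ge> 2" and lam: "lam \<noteq> 0" "lam \<noteq> 1" and mu: "mu \<noteq> 0"
    and p: "param_matrix n p" and q: "param_matrix n q"
    and bij: "bij_betw s (idx n) (idx n)" and t: "x \<in> idx n \<Longrightarrow> t x \<noteq> 0"
    and pull: "quad_dual n mu q b \<Longrightarrow> quad_dual n lam p (\<lambda>x y. t x * t y * b (s x) (s y))"
begin

lemma s_mem: "x \<in> idx n \<Longrightarrow> s x \<in> idx n"
  using bij by (auto simp: bij_betw_def)

lemma s_eq_iff: "x \<in> idx n \<Longrightarrow> y \<in> idx n \<Longrightarrow> s x = s y \<longleftrightarrow> x = y"
  using bij by (auto simp: bij_betw_def inj_on_def)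

text \<open>Both sides of a two term relation contain the same two generators, so the scalars
  \<open>t\<close> cancel and only the permutation remains.\<close>

lemma row:
  assumes b: "quad_dual n mu q b" and ij: "{i, j, m} \<subseteq> {1..n}" "j < m"
  shows "b (s (i, m)) (s (i, j)) = p j m * b (s (i, j)) (s (i, m))"
proof -
  have "t (i, m) \<noteq> 0" "t (i, j) \<noteq> 0" using ij by (auto intro!: t simp: idx_def)
  then show ?thesis using quad_dual_rowD[OF pull[OF b] ij] by (simp add: mult_ac)
qed

lemma col:
  assumes b: "quad_dual n mu q b" and ij: "{i, l, j} \<subseteq> {1..n}" "i < l"
  shows "b (s (l, j)) (s (i, j)) = lam * p l i * b (s (i, j)) (s (l, j))"
proof -
  have "t (l, j) \<noteq> 0" "t (i, j) \<noteq> 0" using ij by (auto intro!: t simp: idx_def)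
  then show ?thesis using quad_dual_colD[OF pull[OF b] ij p] by (simp add: mult_ac)
qed

text \<open>The antidiagonal product enters the three term relation with a nonzero coefficient.
  Hence a form vanishing on both orders of the images of the diagonal must vanish on the images of
  the antidiagonal (\<open>key\<close>). If those images lay in one row, one column or in diagonal
  position, a \<open>pair_form\<close> supported on them alone would contradict this.\<close>

lemma rectangle:
  assumes ij: "{i, l, j, m} \<subseteq> {1..n}" "i < l" "j < m"
  shows "\<exists>i' l' j' m'. i' < l' \<and> j' < m' \<and> {s (i, m), s (l, j)} = {(i', m'), (l', j')} \<and>
    {s (i, j), s (l, m)} = {(i', j'), (l', m')}"
proof -
  have idx: "(i, j) \<in> idx n" "(l, m) \<in> idx n" "(i, m) \<in> idx n" "(l, j) \<in> idx n"
    using ij by (auto simp: idx_def)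
  have Q: "(lam - 1) * p l i * (t (i, m) * t (l, j)) \<noteq> 0"
    using lam t[OF idx(3)] t[OF idx(4)] param_matrix_nz[OF p, of l i] ij by simp
  have key: "b (s (i, m)) (s (l, j)) = 0"
    if "quad_dual n mu q b" "b (s (l, m)) (s (i, j)) = 0" "b (s (i, j)) (s (l, m)) = 0" for b
    using quad_dual_detD[OF pull[OF that(1)] ij] that(2,3) Q by auto
  obtain a b where ab: "s (i, m) = (a, b)" by fastforce
  obtain c d where cd: "s (l, j) = (c, d)" by fastforce
  have mem: "{a, b, c, d} \<subseteq> {1..n}" using s_mem[OF idx(3)] s_mem[OF idx(4)] ab cd by (auto simp: idx_def)
  have distinct: "s (l, m) \<noteq> (a, b)" "s (l, m) \<noteq> (c, d)" "s (i, j) \<noteq> (a, b)" "s (i, j) \<noteq> (c, d)"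
      "s (i, j) \<noteq> s (l, m)" "(a, b) \<noteq> (c, d)"
    using s_eq_iff idx ij(2,3) by (auto simp flip: ab cd)
  have no_pair: False if "quad_dual n mu q (pair_form u v k)" "{u, v} = {(a, b), (c, d)}" "k \<noteq> 0" for u v k
    using key[OF that(1)] that(2,3) distinct unfolding ab cd pair_form_def doubleton_eq_iff
    by (auto split: if_splits)
  have q_nz: "q x y \<noteq> 0" if "{x, y} \<subseteq> {1..n}" for x y using param_matrix_nz[OF q that] .
  have not_row: "a \<noteq> c"
  proof
    assume "a = c"
    then have "b < d \<or> d < b" using distinct by auto
    then show False
      using no_pair[OF quad_dual_row[of b d n mu q a]] no_pair[OF quad_dual_row[of d b n mu q a]] q_nz mem \<open>a = c\<close>
      by (auto simp: insert_commute)
  qed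
  have not_col: "b \<noteq> d"
  proof
    assume "b = d"
    then have "a < c \<or> c < a" using distinct by auto
    then show False
      using no_pair[OF quad_dual_col[OF q, of a c b mu]] no_pair[OF quad_dual_col[OF q, of c a b mu]] q_nz mem mu \<open>b = d\<close>
      by (auto simp: insert_commute)
  qed
  have not_diag: "\<not> (a < c \<and> b < d)" "\<not> (c < a \<and> d < b)"
    using no_pair[OF quad_dual_diag[of a c b d n mu q]] no_pair[OF quad_dual_diag[of c a d b n mu q]] q_nz mem
    by (auto simp: insert_commute)
  have anti: "{s (i, j), s (l, m)} = {(i', j'), (l', m')}"
    if "i' < l'" "j' < m'" "{(a, b), (c, d)} = {(i', m'), (l', j')}" for i' l' j' m'
  proof (rule ccontr)
    \<comment> \<open>This form has a single entry outside the antidiagonal pair. If the diagonal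
      did not map to that entry, \<open>key\<close> would force the form to vanish on the
      antidiagonal pair, where its values are nonzero in both orders.\<close>
    let ?b = "\<lambda>x y. pair_form (i', m') (l', j') (mu * q l' i' * q m' j') x y
      + (if x = (l', m') \<and> y = (i', j') then (mu - 1) * q l' i' else 0)"
    assume *: "{s (i, j), s (l, m)} \<noteq> {(i', j'), (l', m')}"
    have "{l', i', m', j'} \<subseteq> {1..n}" using that(3) mem by (auto simp: doubleton_eq_iff)
    then have nz: "mu * q l' i' * q m' j' \<noteq> 0" using q_nz mu by simp
    have ne: "s (l, m) \<notin> {(i', m'), (l', j')}" "s (i, j) \<notin> {(i', m'), (l', j')}"
      using distinct unfolding that(3)[symmetric] by simp_all
    have "\<not> (s (l, m) = (l', m') \<and> s (i, j) = (i', j'))" "\<not> (s (i, j) = (l', m') \<and> s (l, m) = (i', j'))"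
      using * by (auto simp: insert_commute)
    then have "?b (s (l, m)) (s (i, j)) = 0" "?b (s (i, j)) (s (l, m)) = 0"
      using ne by (auto simp: pair_form_def)
    from key[OF quad_dual_anti[OF that(1,2)] this] have 0: "?b (a, b) (c, d) = 0"
      unfolding ab cd .
    have "(a, b) \<noteq> (l', m')" using that by (auto simp: doubleton_eq_iff)
    with 0 have 1: "pair_form (i', m') (l', j') (mu * q l' i' * q m' j') (a, b) (c, d) = 0"
      by (auto split: if_splits)
    from that(3) have "(a, b) = (i', m') \<and> (c, d) = (l', j') \<or> (a, b) = (l', j') \<and> (c, d) = (i', m')"
      unfolding doubleton_eq_iff .
    then show False using 1 nz that(1) unfolding pair_form_def by (elim disjE conjE) simp_all
  qed
  from not_row not_col not_diag consider "a < c" "d < b" | "c < a" "b < d" by linarith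
  then show ?thesis
  proof cases
    case 1
    show ?thesis
      unfolding ab cd using 1 anti[OF 1 refl] by blast
  next
    case 2
    show ?thesis
      unfolding ab cd using 2 anti[OF 2 insert_commute] insert_commute[of "(a, b)" "(c, d)" "{}"] by blast
  qed
qed

text \<open>Forms supported on one row or one column of the target are evaluated on row and column
  relations of the source. Row relations carry entries of \<open>p\<close>, column relations carry
  \<open>lam\<close> times such entries; together they determine both \<open>p\<close> and the
  relation between \<open>lam\<close> and \<open>mu\<close>.\<close>

lemma params:
  "(lam = mu \<and> (\<forall>i\<in>{1..n}. \<forall>j\<in>{1..n}. p i j = q i j)) \<or>
   (lam = mu \<and> (\<forall>i\<in>{1..n}. \<forall>j\<in>{1..n}. i > j \<longrightarrow> p i j = inverse lam * q j i)) \<or>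
   (lam = inverse mu \<and> (\<forall>i\<in>{1..n}. \<forall>j\<in>{1..n}. p i j = q (n + 1 - i) (n + 1 - j))) \<or>
   (lam = inverse mu \<and> (\<forall>i\<in>{1..n}. \<forall>j\<in>{1..n}. i > j \<longrightarrow>
      p i j = inverse lam * q (n + 1 - j) (n + 1 - i)))"
proof -
  \<comment> \<open>Opposite entries of \<open>p\<close> and of \<open>r\<close> are mutually
    inverse, so agreement above the diagonal is enough.\<close>
  have p_ext: "p i j = r i j" if "\<And>i j. {i, j} \<subseteq> {1..n} \<Longrightarrow> i < j \<Longrightarrow> p i j = r i j"
     "\<And>i j. {i, j} \<subseteq> {1..n} \<Longrightarrow> r i j * r j i = 1" "\<And>i. i \<in> {1..n} \<Longrightarrow> r i i = 1"
    "{i, j} \<subseteq> {1..n}" for r i j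
  proof (cases i j rule: linorder_cases)
    case equal
    moreover have "p j j = 1" using p that(4) unfolding param_matrix_def by blast
    ultimately show ?thesis using that(3)[of j] that(4) by simp
  next
    case greater
    have "p j i * p i j = 1" "r j i * r i j = 1" "p j i = r j i"
      using param_matrix_inv[OF p, of j i] that(1)[of j i] that(2)[of j i] that(4) greater by simp_all
    then show ?thesis by (metis inverse_unique)
  qed (use that(1,4) in blast)
  have qq: "q i j * q j i = 1" if "{i, j} \<subseteq> {1..n}" for i j
    using param_matrix_inv[OF q that] .
  have q1: "q i i = 1" if "i \<in> {1..n}" for i
    using q that unfolding param_matrix_def by blast
  let ?r = "\<lambda>i. n + 1 - i"
  have r: "?r i \<in> {1..n}" if "i \<in> {1..n}" for i using that by auto
  have qr: "q (?r i) (?r j) * q (?r j) (?r i) = 1" if "{i, j} \<subseteq> {1..n}" for i j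
    by (rule qq) (use that r[of i] r[of j] in blast)
  have r_less: "?r l < ?r i" if "i < l" "l \<in> {1..n}" for i l using that by auto
  show ?thesis
  proof (rule rectangle_map_cases[of n s])
    assume id: "\<And>i j. i \<in> {1..n} \<Longrightarrow> j \<in> {1..n} \<Longrightarrow> s (i, j) = (i, j)"
    have pq: "p i j = q i j" if "{i, j} \<subseteq> {1..n}" "i < j" for i j
      using row[OF quad_dual_row[OF that(2), of n mu q 1], of 1 i j] that id n2 by (simp add: pair_form_def)
    have "p i j = q i j" if "{i, j} \<subseteq> {1..n}" for i j
      using p_ext[of q, OF pq qq q1 that] .
    moreover have "lam * p 2 1 = mu * q 2 1"
      using col[OF quad_dual_col[OF q, of 1 2 1 mu], of 1 2 1] id n2 by (simp add: pair_form_def)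
    moreover have "q 2 1 \<noteq> 0" using param_matrix_nz[OF q, of 2 1] n2 by simp
    ultimately show ?thesis using n2 by simp
  next
    assume transpose: "\<And>i j. i \<in> {1..n} \<Longrightarrow> j \<in> {1..n} \<Longrightarrow> s (i, j) = (j, i)"
    have 1: "p i j = mu * q j i" if "{i, j} \<subseteq> {1..n}" "i < j" for i j
      using row[OF quad_dual_col[OF q that(2), of 1 mu], of 1 i j] that transpose n2
      by (simp add: pair_form_def)
    have 2: "lam * p i j = q j i" if "{i, j} \<subseteq> {1..n}" "j < i" for i j
      using col[OF quad_dual_row[OF that(2), of n mu q 1], of j i 1] that transpose n2
      by (simp add: pair_form_def)
    have "lam = lam * (p 1 2 * p 2 1)" using param_matrix_inv[OF p, of 1 2] n2 by simp
    also have "\<dots> = p 1 2 * (lam * p 2 1)" by (simp add: mult_ac)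
    also have "\<dots> = mu * (q 2 1 * q 1 2)" using 1[of 1 2] 2[of 2 1] n2 by (simp add: mult_ac)
    also have "\<dots> = mu" using qq[of 2 1] n2 by simp
    finally have "lam = mu" .
    moreover have "p i j = inverse lam * q j i" if "{i, j} \<subseteq> {1..n}" "j < i" for i j
      using 2[OF that] lam by (simp add: field_simps)
    ultimately show ?thesis by simp
  next
    assume rotate: "\<And>i j. i \<in> {1..n} \<Longrightarrow> j \<in> {1..n} \<Longrightarrow> s (i, j) = (?r i, ?r j)"
    have pq: "p i j = q (?r i) (?r j)" if "{i, j} \<subseteq> {1..n}" "i < j" for i j
    proof -
      \<comment> \<open>Rotation reverses the order within a row, so the entry 1 of the form appears
        on the left and its entry \<open>q (?r j) (?r i)\<close> on the right.\<close>
      have "1 = p i j * q (?r j) (?r i)"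
        using row[OF quad_dual_row[OF r_less[OF that(2)], of n mu q "?r 1"], of 1 i j] that rotate n2
        by (auto simp: pair_form_def r split: if_splits)
      moreover have "q (?r j) (?r i) * q (?r i) (?r j) = 1" using qr[of j i] that by simp
      ultimately show ?thesis by (metis mult.commute inverse_unique)
    qed
    have all: "p i j = q (?r i) (?r j)" if "{i, j} \<subseteq> {1..n}" for i j
      by (rule p_ext[of "\<lambda>i j. q (?r i) (?r j)", OF pq _ _ that]) (use qr q1 r in blast)+
    have "1 = lam * p 2 1 * (mu * q (?r 1) (?r 2))"
      using col[OF quad_dual_col[OF q, of "?r 2" "?r 1" "?r 1" mu], of 1 2 1] rotate n2
      by (auto simp: pair_form_def split: if_splits)
    also have "\<dots> = lam * mu * (q (?r 2) (?r 1) * q (?r 1) (?r 2))"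
      using all[of 2 1] n2 by (simp add: mult_ac)
    also have "\<dots> = lam * mu" using qr[of 2 1] n2 by simp
    finally have "lam = inverse mu" using mu by (simp add: field_simps)
    then show ?thesis using all by simp
  next
    assume antitranspose: "\<And>i j. i \<in> {1..n} \<Longrightarrow> j \<in> {1..n} \<Longrightarrow> s (i, j) = (?r j, ?r i)"
    have 1: "1 = p i j * (mu * q (?r i) (?r j))" if "{i, j} \<subseteq> {1..n}" "i < j" for i j
      using row[OF quad_dual_col[OF q r_less[OF that(2)], of "?r 1" mu], of 1 i j] that antitranspose n2
      by (auto simp: pair_form_def r split: if_splits)
    have 2: "1 = lam * p i j * q (?r i) (?r j)" if "{i, j} \<subseteq> {1..n}" "j < i" for i j
      using col[OF quad_dual_row[OF r_less[OF that(2)], of n mu q "?r 1"], of j i 1] that antitranspose n2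
      by (auto simp: pair_form_def r split: if_splits)
    have "1 = (p 1 2 * (mu * q (?r 1) (?r 2))) * (lam * p 2 1 * q (?r 2) (?r 1))"
      using 1[of 1 2] 2[of 2 1] n2 by simp
    also have "\<dots> = lam * mu * (p 1 2 * p 2 1) * (q (?r 1) (?r 2) * q (?r 2) (?r 1))"
      by (simp only: mult_ac)
    also have "\<dots> = lam * mu" using qr[of 1 2] param_matrix_inv[OF p, of 1 2] n2 by simp
    finally have "lam = inverse mu" using mu by (simp add: field_simps)
    moreover have "p i j = inverse lam * q (?r j) (?r i)" if "{i, j} \<subseteq> {1..n}" "j < i" for i j
    proof -
      have "q (?r i) (?r j) * q (?r j) (?r i) = 1" using qr[OF that(1)] .
      have "inverse lam * q (?r j) (?r i) = inverse lam * (lam * p i j * q (?r i) (?r j)) * q (?r j) (?r i)"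
        using 2[OF that] by simp
      also have "\<dots> = inverse lam * lam * p i j * (q (?r i) (?r j) * q (?r j) (?r i))"
        by (simp only: mult_ac)
      also have "\<dots> = p i j" using lam \<open>q (?r i) (?r j) * _ = 1\<close> by simp
      finally show ?thesis ..
    qed
    ultimately show ?thesis by simp
  qed (fact n2, erule s_mem, rule rectangle)
qed

end

section \<open>Renaming of generators\<close>

definition map_fword :: "('a \<Rightarrow> 'b) \<Rightarrow> 'a fword \<Rightarrow> 'b fword" where
  "map_fword s w = FWord (map s (letters w))"

locale letter_involution =
  fixes s :: "'a \<Rightarrow> 'a"
  assumes invol [simp]: "s (s x) = x"
begin

lemma map_fword_twice [simp]: "map_fword s (map_fword s w) = w"
  by (cases w) (simp add: map_fword_def comp_def)

lemma inj_map_fword: "inj (map_fword s)"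
  by (rule inj_on_inverseI[of _ "map_fword s"]) simp

text \<open>\<open>map_key\<close> precomposes the coefficient function and thus substitutes letters
  by the inverse of \<open>s\<close>; for an involution this is \<open>s\<close> itself.\<close>

definition rename :: "('a fword \<Rightarrow>\<^sub>0 'k::field) \<Rightarrow> 'a fword \<Rightarrow>\<^sub>0 'k" where
  "rename = Poly_Mapping.map_key (map_fword s)"

lemma lookup_rename: "Poly_Mapping.lookup (rename f) w = Poly_Mapping.lookup f (map_fword s w)"
  by (simp add: rename_def map_key.rep_eq[OF inj_map_fword])

lemma rename_rename [simp]: "rename (rename f) = f"
  by (rule poly_mapping_eqI) (simp add: lookup_rename)

lemma rename_add [simp]: "rename (f + g) = rename f + rename g"
  by (rule poly_mapping_eqI) (simp add: lookup_rename lookup_add)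

lemma rename_diff [simp]: "rename (f - g) = rename f - rename g"
  by (rule poly_mapping_eqI) (simp add: lookup_rename lookup_minus)

lemma rename_mult [simp]: "rename (f * g) = rename f * rename g"
proof (rule poly_mapping_eqI)
  fix w :: "'a fword"
  show "Poly_Mapping.lookup (rename (f * g)) w = Poly_Mapping.lookup (rename f * rename g) w"
    by (cases w) (simp add: lookup_rename lookup_times_fword map_fword_def take_map drop_map)
qed

lemma rename_scal [simp]: "rename (scal c) = scal c"
proof (rule poly_mapping_eqI)
  fix w :: "'a fword"
  show "Poly_Mapping.lookup (rename (scal c)) w = Poly_Mapping.lookup (scal c) w"
    by (cases w) (auto simp: lookup_rename lookup_single when_def map_fword_def zero_fword_def)
qed

lemma rename_one [simp]: "rename 1 = 1"
  using rename_scal[of 1] by simp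

lemma rename_zero [simp]: "rename 0 = 0"
  by (rule poly_mapping_eqI) (simp add: lookup_rename)

lemma rename_gen [simp]: "rename (gen x) = gen (s x)"
proof (rule poly_mapping_eqI)
  fix w :: "'a fword"
  have "map s (letters w) = [x] \<longleftrightarrow> letters w = [s x]" by auto
  then show "Poly_Mapping.lookup (rename (gen x)) w = Poly_Mapping.lookup (gen (s x)) w"
    by (cases w) (auto simp: lookup_rename lookup_single when_def map_fword_def gen_def)
qed

lemma rename_closed:
  assumes "\<And>x. x \<in> S \<Longrightarrow> s x \<in> S" "f \<in> carrier (free_algebra S)"
  shows "rename f \<in> carrier (free_algebra S)"
proof -
  have "set (letters w) \<subseteq> S" if "w \<in> Poly_Mapping.keys (rename f)" for w
  proof
    fix x assume x: "x \<in> set (letters w)"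
    have "map_fword s w \<in> Poly_Mapping.keys f" using that by (simp add: in_keys_iff lookup_rename)
    then have "set (letters (map_fword s w)) \<subseteq> S" using assms(2) by (simp add: free_algebra_def)
    then have "s x \<in> S" using x by (auto simp: map_fword_def)
    then show "x \<in> S" using assms(1)[of "s x"] by simp
  qed
  then show ?thesis by (simp add: free_algebra_def)
qed

end

lemma qmat_ideal_memI:
  assumes "r \<in> qmat_ideal n lam p" "r' \<in> qmat_ideal n lam p"
  shows "scal c * r + scal c' * r' \<in> qmat_ideal n lam p" "scal c * r \<in> qmat_ideal n lam p"
proof -
  interpret ideal "qmat_ideal n lam p" "qmat_free n" by (rule ideal_qmat)
  show *: "scal c * r \<in> qmat_ideal n lam p"
    using I_l_closed[OF assms(1) scal_in_free_algebra, of c] by simp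
  show "scal c * r + scal c' * r' \<in> qmat_ideal n lam p"
    using additive_subgroup.a_closed[OF ideal.axioms(1)[OF ideal_qmat] * I_l_closed[OF assms(2) scal_in_free_algebra, of c', simplified]] by simp
qed

locale index_involution = letter_involution s for s :: "nat \<times> nat \<Rightarrow> nat \<times> nat" +
  fixes n :: nat
  assumes s: "x \<in> idx n \<Longrightarrow> s x \<in> idx n"
begin

text \<open>The preimage of an ideal under renaming is an ideal, so membership need only be tested
  on the defining relations.\<close>

lemma rename_ideal:
  fixes lam mu :: "'k::field" and p q :: "nat \<Rightarrow> nat \<Rightarrow> 'k"
  assumes rel: "\<And>r. r \<in> qmat_relations n lam p \<Longrightarrow> rename r \<in> qmat_ideal n mu q"
    and f: "f \<in> qmat_ideal n lam p"
  shows "rename f \<in> qmat_ideal n mu q"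
proof -
  interpret ideal "qmat_ideal n mu q" "qmat_free n" by (rule ideal_qmat)
  let ?J = "{f \<in> carrier (qmat_free n). rename f \<in> qmat_ideal n mu q}"
  have "ideal ?J (qmat_free n)"
  proof (rule ideal_free_algebraI)
    show "0 \<in> ?J" using additive_subgroup.zero_closed[OF ideal.axioms(1)[OF ideal_qmat]] zero_closed by simp
    show "f + g \<in> ?J" if "f \<in> ?J" "g \<in> ?J" for f g
      using that additive_subgroup.a_closed[OF ideal.axioms(1)[OF ideal_qmat[of n mu q]]]
      by (force simp: add_in_free_algebra)
    fix f g :: "(nat \<times> nat) fword \<Rightarrow>\<^sub>0 'k"
    assume f: "f \<in> ?J" and g: "g \<in> carrier (qmat_free n)"
    then have "rename f \<in> qmat_ideal n mu q" "rename g \<in> carrier (qmat_free n)"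
      using rename_closed[OF s] by blast+
    from I_l_closed[OF this] I_r_closed[OF this] f g show "g * f \<in> ?J" "f * g \<in> ?J"
      by (simp_all add: mult_in_free_algebra)
  qed blast
  moreover have "qmat_relations n lam p \<subseteq> ?J"
    using rel qmat_relations_subset[of n lam p] by (auto simp: idx_def)
  ultimately have "qmat_ideal n lam p \<subseteq> ?J"
    unfolding qmat_ideal_def by (intro ring.genideal_minimal ring_free_algebra)
  with f show ?thesis by blast
qed

text \<open>As renaming is involutive and respects the ideals in both directions, taking images
  under it sends cosets to cosets and is inverse to itself.\<close>

lemma qmat_iso_rename:
  fixes lam mu :: "'k::field" and p q :: "nat \<Rightarrow> nat \<Rightarrow> 'k"
  assumes rel: "\<And>r. r \<in> qmat_relations n lam p \<Longrightarrow> rename r \<in> qmat_ideal n mu q"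
    and rel': "\<And>r. r \<in> qmat_relations n mu q \<Longrightarrow> rename r \<in> qmat_ideal n lam p"
  shows "is_algebra_iso (qmat_algebra n lam p) (qmat_algebra n mu q)"
proof -
  let ?A = "qmat_algebra n lam p" and ?B = "qmat_algebra n mu q"
  define C where "C f = qmat_ideal n lam p +>\<^bsub>qmat_free n\<^esub> f" for f
  define D where "D f = qmat_ideal n mu q +>\<^bsub>qmat_free n\<^esub> f" for f
  note opsC = qmat_coset_ops[where n = n and lam = lam and p = p, folded C_def]
  note opsD = qmat_coset_ops[where n = n and lam = mu and p = q, folded D_def]
  note cl = add_in_free_algebra mult_in_free_algebra scal_in_free_algebra one_in_free_algebra rename_closed[OF s]
  have I: "rename f \<in> qmat_ideal n mu q" if "f \<in> qmat_ideal n lam p" for f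
    using rename_ideal[OF rel that] .
  have J: "rename f \<in> qmat_ideal n lam p" if "f \<in> qmat_ideal n mu q" for f
    using rename_ideal[OF rel' that] .
  have CD: "rename ` C f = D (rename f)" for f
    unfolding C_def D_def a_r_coset_def' using I J by (force simp: image_iff)
  have DC: "rename ` D f = C (rename f)" for f
    unfolding C_def D_def a_r_coset_def' using I J by (force simp: image_iff)
  have A: "\<exists>f. f \<in> carrier (qmat_free n) \<and> U = C f" if "U \<in> carrier ?A" for U
    using qmat_carrier_elim[OF that] unfolding C_def by metis
  have B: "\<exists>f. f \<in> carrier (qmat_free n) \<and> U = D f" if "U \<in> carrier ?B" for U
    using qmat_carrier_elim[OF that] unfolding D_def by metis
  have "(`) rename \<in> ring_iso ?A ?B"
  proof (rule ring_iso_memI)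
    show "rename ` U \<in> carrier ?B" if "U \<in> carrier ?A" for U
      using A[OF that] by (auto simp: CD opsD cl)
    show "rename ` (U \<otimes>\<^bsub>?A\<^esub> V) = rename ` U \<otimes>\<^bsub>?B\<^esub> rename ` V"
      "rename ` (U \<oplus>\<^bsub>?A\<^esub> V) = rename ` U \<oplus>\<^bsub>?B\<^esub> rename ` V" 
      if "U \<in> carrier ?A" "V \<in> carrier ?A" for U V
      using A[OF that(1)] A[OF that(2)] by (elim exE conjE, simp add: CD opsC opsD cl)+
    show "rename ` \<one>\<^bsub>?A\<^esub> = \<one>\<^bsub>?B\<^esub>"
      using opsC(2)[OF one_in_free_algebra] opsD(2)[OF one_in_free_algebra] by (simp add: CD)
    show "bij_betw ((`) rename) (carrier ?A) (carrier ?B)"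
    proof (rule bij_betw_byWitness[where f' = "(`) rename"])
      show "(`) rename ` carrier ?A \<subseteq> carrier ?B" 
        using A by (auto simp: CD opsD cl dest!: A)
      show "(`) rename ` carrier ?B \<subseteq> carrier ?A"
        using B by (auto simp: DC opsC cl dest!: B)
    qed (simp_all add: image_image)
  qed
  moreover have "rename ` (c \<odot>\<^bsub>?A\<^esub> U) = c \<odot>\<^bsub>?B\<^esub> rename ` U" if "U \<in> carrier ?A" for c U
    using A[OF that] by (elim exE conjE) (simp add: CD opsC opsD cl)
  ultimately show ?thesis
    unfolding is_algebra_iso_def algebra_iso_def by blast
qed

end

section \<open>Transposition and rotation\<close>

lemma scal_scal_mult: "scal a * (scal b * x) = scal (a * b) * x"
  by (simp add: mult.assoc[symmetric] mult_single)

lemma scal_combination: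
  "scal a * (X - (scal b * Y + scal c * W)) + scal d * (Z - scal e * W) =
    scal a * X - (scal (a * b) * Y + scal (- d) * Z) - scal (a * c + d * e) * W"
  by (simp add: algebra_simps scal_scal_mult single_add single_uminus)

lemma qmat_ideal_relations:
  assumes "{l, m, i, j} \<subseteq> {1..n}"
  shows "i < l \<Longrightarrow> j < m \<Longrightarrow> gen2 l m * gen2 i j -
      (scal (p l i * p j m) * (gen2 i j * gen2 l m) + scal ((lam - 1) * p l i) * (gen2 i m * gen2 l j))
      \<in> qmat_ideal n lam p"
    and "i < l \<Longrightarrow> m \<le> j \<Longrightarrow> gen2 l m * gen2 i j - scal (lam * p l i * p j m) * (gen2 i j * gen2 l m)
      \<in> qmat_ideal n lam p"
    and "j < m \<Longrightarrow> gen2 i m * gen2 i j - scal (p j m) * (gen2 i j * gen2 i m) \<in> qmat_ideal n lam p"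
  using qmat_relations_eqv[OF assms, of lam p] unfolding qmat_eqv_def by simp_all

text \<open>Replaces the antidiagonal product \<open>W\<close> of a three term relation by its
  reversal \<open>Z\<close>; \<open>d\<close> is the coefficient for which \<open>W\<close>
  cancels.\<close>

lemma qmat_ideal_combination:
  assumes "X - (scal b * Y + scal c * W) \<in> qmat_ideal n lam p" "Z - scal e * W \<in> qmat_ideal n lam p"
    and "a \<noteq> 0" "d = a * c / e" "e \<noteq> 0"
  shows "scal a * X - (scal (a * b) * Y + scal d * Z) \<in> qmat_ideal n lam p"
proof -
  have "scal a * (X - (scal b * Y + scal c * W)) + scal (- d) * (Z - scal e * W) =
      scal a * X - (scal (a * b) * Y + scal d * Z)"
    using assms(4,5) by (simp add: scal_combination)
  then show ?thesis using qmat_ideal_memI(1)[OF assms(1,2), of a "- d"] by simp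
qed

lemma qmat_ideal_flip:
  assumes "Y - scal e * X \<in> qmat_ideal n lam p" "a * e = 1"
  shows "X - scal a * Y \<in> qmat_ideal n lam p"
proof -
  have "scal (- a) * (Y - scal e * X) = X - scal a * Y"
    using assms(2) by (simp add: algebra_simps scal_scal_mult single_uminus)
  then show ?thesis using qmat_ideal_memI(2)[OF assms(1) assms(1), of "- a"] by simp
qed

lemma index_involution_swap: "index_involution prod.swap n"
  by unfold_locales (auto simp: idx_def)

text \<open>In a transposed three term relation the antidiagonal product stands in the opposite
  order to that of the target relation, and \<open>2\<close> reorders it.\<close>

lemma rename_relation_transpose:
  fixes lam :: "'k::field"
  assumes p: "param_matrix n p" and lam: "lam \<noteq> 0" and r: "r \<in> qmat_relations n lam p"
  shows "letter_involution.rename prod.swap r \<in> qmat_ideal n lam (transpose_params lam p)"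
proof -
  interpret index_involution prod.swap n by (rule index_involution_swap)
  let ?q = "transpose_params lam p"
  have inv: "p i j * p j i = 1" if "{i, j} \<subseteq> {1..n}" for i j
    using param_matrix_inv[OF p that] .
  have up: "?q i j = lam * p j i" if "i < j" for i j using that by (simp add: transpose_params_def)
  have dn: "?q i j = inverse lam * p j i" if "j < i" for i j using that by (simp add: transpose_params_def)
  from r show ?thesis
  proof (cases rule: qmat_relations_cases)
    case (det l m i j)
    have pli: "p i l * p l i = 1" "p l i \<noteq> 0" "p i l \<noteq> 0" "p m j \<noteq> 0" "p j m \<noteq> 0"
      using inv[of i l] param_matrix_nz[OF p] det(1) by auto
    have 1: "gen2 m l * gen2 j i - (scal (?q m j * ?q i l) * (gen2 j i * gen2 m l) +
        scal ((lam - 1) * ?q m j) * (gen2 j l * gen2 m i)) \<in> qmat_ideal n lam ?q"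
      by (rule qmat_ideal_relations(1)) (use det in auto)
    have 2: "gen2 m i * gen2 j l - scal (lam * ?q m j * ?q l i) * (gen2 j l * gen2 m i) \<in> qmat_ideal n lam ?q"
      by (rule qmat_ideal_relations(2)) (use det in auto)
    have "scal 1 * (gen2 m l * gen2 j i) - (scal (1 * (?q m j * ?q i l)) * (gen2 j i * gen2 m l) +
        scal ((lam - 1) * p l i) * (gen2 m i * gen2 j l)) \<in> qmat_ideal n lam ?q"
    proof (rule qmat_ideal_combination[OF 1 2])
      have pinv: "p l i = inverse (p i l)" using inverse_unique[OF pli(1)] by simp
      show "(lam - 1) * p l i = 1 * ((lam - 1) * ?q m j) / (lam * ?q m j * ?q l i)"
        unfolding pinv using pli(3-5) lam det(2,3) by (simp add: dn field_simps)
    qed (use pli lam det in \<open>simp_all add: dn\<close>)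
    moreover have "?q m j * ?q i l = p l i * p j m" using det lam by (simp add: up dn)
    ultimately show ?thesis by (simp add: det(4))
  next
    case (anti l m i j)
    \<comment> \<open>For \<open>m = j\<close> a column relation turns into a row relation. For
      \<open>m < j\<close> the result is an antidiagonal relation read from right to left.\<close>
    show ?thesis
    proof (cases "m = j")
      case True
      have "p j j = 1" using p anti(1) unfolding param_matrix_def by blast
      then show ?thesis
        using qmat_ideal_relations(3)[of l l j i n ?q lam] anti True by (simp add: up)
    next
      case False
      have "gen2 j i * gen2 m l - scal (lam * ?q j m * ?q l i) * (gen2 m l * gen2 j i) \<in> qmat_ideal n lam ?q"
        by (rule qmat_ideal_relations(2)) (use anti False in auto)
      moreover have "lam * p l i * p j m * (lam * ?q j m * ?q l i) = 1"
      proof -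
        have *: "lam * p l i * p j m * (lam * ?q j m * ?q l i) =
            (lam * inverse lam) * (lam * inverse lam) * (p l i * p i l) * (p j m * p m j)"
          using anti False by (simp add: dn mult_ac)
        show ?thesis unfolding * using inv[of l i] inv[of j m] anti(1) lam by simp
      qed
      ultimately show ?thesis
        using qmat_ideal_flip by (simp add: anti(4))
    qed
  next
    case (row m i j)
    have "lam * ?q m j * ?q i i = p j m"
      using row(2) lam by (simp add: transpose_params_def)
    then show ?thesis
      using qmat_ideal_relations(2)[of m i j i n lam ?q] row by simp
  qed
qed

lemma qmat_relations_cong:
  assumes "\<And>i j. i \<in> {1..n} \<Longrightarrow> j \<in> {1..n} \<Longrightarrow> p i j = p' i j"
  shows "qmat_relations n lam p = qmat_relations n lam p'"
proof -
  have "qmat_relations n lam p \<subseteq> qmat_relations n lam p'"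
    if "\<And>i j. i \<in> {1..n} \<Longrightarrow> j \<in> {1..n} \<Longrightarrow> p i j = p' i j" for p p'
  proof
    fix r assume "r \<in> qmat_relations n lam p"
    then show "r \<in> qmat_relations n lam p'"
    proof (cases rule: qmat_relations_cases)
      case (det l m i j)
      have "gen2 l m * gen2 i j - (scal (p' l i * p' j m) * (gen2 i j * gen2 l m)
          + scal ((lam - 1) * p' l i) * (gen2 i m * gen2 l j)) \<in> qmat_relations n lam p'"
        using det(1-3) unfolding qmat_relations_def by blast
      moreover have "p l i = p' l i" "p j m = p' j m" using det(1) that by auto
      ultimately show ?thesis using det(4) by simp
    next
      case (anti l m i j)
      have "gen2 l m * gen2 i j - scal (lam * p' l i * p' j m) * (gen2 i j * gen2 l m) \<in> qmat_relations n lam p'"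
        using anti(1-3) unfolding qmat_relations_def by blast
      moreover have "p l i = p' l i" "p j m = p' j m" using anti(1) that by auto
      ultimately show ?thesis using anti(4) by simp
    next
      case (row m i j)
      have "gen2 i m * gen2 i j - scal (p' j m) * (gen2 i j * gen2 i m) \<in> qmat_relations n lam p'"
        using row(1,2) unfolding qmat_relations_def by blast
      moreover have "p j m = p' j m" using row(1) that by auto
      ultimately show ?thesis using row(3) by simp
    qed
  qed
  from this[of p p'] this[of p' p] assms show ?thesis by simp
qed

lemma qmat_cong:
  assumes "\<And>i j. i \<in> {1..n} \<Longrightarrow> j \<in> {1..n} \<Longrightarrow> p i j = p' i j"
  shows "qmat_algebra n lam p = qmat_algebra n lam p'" "qmat_ideal n lam p = qmat_ideal n lam p'"
  unfolding qmat_algebra_def qmat_ideal_def using qmat_relations_cong[OF assms] by simp_all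

lemma qmat_iso_transpose:
  fixes lam :: "'k::field"
  assumes p: "param_matrix n p" and lam: "lam \<noteq> 0"
  shows "is_algebra_iso (qmat_algebra n lam p) (qmat_algebra n lam (transpose_params lam p))"
proof -
  interpret index_involution prod.swap n by (rule index_involution_swap)
  show ?thesis
  proof (rule qmat_iso_rename)
    fix r assume r: "r \<in> qmat_relations n lam (transpose_params lam p)"
    have "rename r \<in> qmat_ideal n lam (transpose_params lam (transpose_params lam p))"
      by (rule rename_relation_transpose[OF param_matrix_transpose[OF p lam] lam r])
    also have "\<dots> = qmat_ideal n lam p"
      by (rule qmat_cong(2)) (rule transpose_params_twice[OF p lam])
    finally show "rename r \<in> qmat_ideal n lam p" .
  qed (rule rename_relation_transpose[OF p lam])
qed

definition rotate_params :: "nat \<Rightarrow> (nat \<Rightarrow> nat \<Rightarrow> 'k) \<Rightarrow> nat \<Rightarrow> nat \<Rightarrow> 'k" where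
  "rotate_params n p i j = p (n + 1 - i) (n + 1 - j)"

text \<open>Indices outside \<open>{1..n}\<close> are fixed because truncated subtraction would break involutivity there.\<close>

definition rotate_index :: "nat \<Rightarrow> nat \<times> nat \<Rightarrow> nat \<times> nat" where
  "rotate_index n x = (if x \<in> idx n then (n + 1 - fst x, n + 1 - snd x) else x)"

lemma index_involution_rotate: "index_involution (rotate_index n) n"
  by unfold_locales (auto simp: idx_def rotate_index_def)

text \<open>Rotation reverses the order of the generators, so each target relation is solved for the
  reversed product; this inverts \<open>lam\<close>. Multiplying by \<open>- ?a\<close> makes the
  coefficient of \<open>?X\<close> a unit sign, and reordering the antidiagonal product turns
  \<open>inverse lam - 1\<close> into \<open>lam - 1\<close>.\<close>

lemma rename_relation_rotate:
  fixes lam :: "'k::field"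
  assumes p: "param_matrix n p" and lam: "lam \<noteq> 0" and r: "r \<in> qmat_relations n lam p"
  shows "letter_involution.rename (rotate_index n) r \<in> qmat_ideal n (inverse lam) (rotate_params n p)"
proof -
  interpret index_involution "rotate_index n" n by (rule index_involution_rotate)
  let ?q = "rotate_params n p" and ?r = "\<lambda>i. n + 1 - i"
  have inv: "p i j * p j i = 1" if "{i, j} \<subseteq> {1..n}" for i j
    using param_matrix_inv[OF p that] .
  have s: "rotate_index n (i, j) = (?r i, ?r j)" if "{i, j} \<subseteq> {1..n}" for i j
    using that by (simp add: rotate_index_def idx_def)
  have mem: "{?r l, ?r m, ?r i, ?r j} \<subseteq> {1..n}" if "{l, m, i, j} \<subseteq> {1..n}" for i j l m
    using that by auto
  have less: "?r l < ?r i" if "i < l" "l \<le> n" for i l using that by auto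
  have q: "?q (?r i) (?r j) = p i j" if "{i, j} \<subseteq> {1..n}" for i j
    using that by (simp add: rotate_params_def)
  from r show ?thesis
  proof (cases rule: qmat_relations_cases)
    case (det l m i j)
    have nz: "p i l * p l i = 1" "p j m * p m j = 1" "p l i \<noteq> 0" "p i l \<noteq> 0" "p m j \<noteq> 0" "p j m \<noteq> 0"
      using inv[of i l] inv[of j m] param_matrix_nz[OF p] det(1) by auto
    have ids: "{?r i, ?r j, ?r l, ?r m} \<subseteq> {1..n}" "{?r i, ?r m, ?r l, ?r j} \<subseteq> {1..n}" using mem det(1) by blast+
    have lt: "?r l < ?r i" "?r m < ?r j" using less det by auto
    have qs: "?q (?r i) (?r l) = p i l" "?q (?r m) (?r j) = p m j" "?q (?r j) (?r m) = p j m"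
      using q det(1) by auto
    let ?X = "gen2 (?r l) (?r m) * gen2 (?r i) (?r j)" and ?Y = "gen2 (?r i) (?r j) * gen2 (?r l) (?r m)"
      and ?Z = "gen2 (?r i) (?r m) * gen2 (?r l) (?r j)" and ?W = "gen2 (?r l) (?r j) * gen2 (?r i) (?r m)"
    have 1: "?Y - (scal (p i l * p m j) * ?X + scal ((inverse lam - 1) * p i l) * ?W) \<in> qmat_ideal n (inverse lam) ?q"
      using qmat_ideal_relations(1)[OF ids(1) lt, of ?q "inverse lam"] unfolding qs .
    have 2: "?Z - scal (inverse lam * p i l * p j m) * ?W \<in> qmat_ideal n (inverse lam) ?q"
      using qmat_ideal_relations(2)[OF ids(2) lt(1) less_imp_le[OF lt(2)], of "inverse lam" ?q] unfolding qs .
    let ?a = "p l i * p j m"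
    have "scal (- ?a) * ?Y - (scal (- ?a * (p i l * p m j)) * ?X + scal ((lam - 1) * p l i) * ?Z)
        \<in> qmat_ideal n (inverse lam) ?q"
    proof (rule qmat_ideal_combination[OF 1 2])
      have pinv: "p l i = inverse (p i l)" using inverse_unique[OF nz(1)] by simp
      show "(lam - 1) * p l i = - ?a * ((inverse lam - 1) * p i l) / (inverse lam * p i l * p j m)"
        unfolding pinv using nz(4-6) lam by (simp add: field_simps)
    qed (use nz lam in auto)
    moreover have "- ?a * (p i l * p m j) = - 1"
    proof -
      have *: "- ?a * (p i l * p m j) = - ((p i l * p l i) * (p j m * p m j))" by (simp add: mult_ac)
      show ?thesis unfolding * nz(1,2) by simp
    qed
    ultimately have "?X - (scal ?a * ?Y + scal ((lam - 1) * p l i) * ?Z) \<in> qmat_ideal n (inverse lam) ?q"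
      by (simp add: single_uminus algebra_simps)
    then show ?thesis using det s by simp
  next
    case (anti l m i j)
    have ids: "{?r i, ?r j, ?r l, ?r m} \<subseteq> {1..n}" using mem anti(1) by blast
    have lt: "?r l < ?r i" "?r j \<le> ?r m" using less anti by auto
    have qs: "?q (?r i) (?r l) = p i l" "?q (?r m) (?r j) = p m j" using q anti(1) by auto
    have *: "lam * p l i * p j m * (inverse lam * p i l * p m j) = (lam * inverse lam) * (p i l * p l i) * (p j m * p m j)"
      by (simp add: mult_ac)
    have "lam * p l i * p j m * (inverse lam * p i l * p m j) = 1"
      unfolding * using inv[of i l] inv[of j m] anti(1) lam by simp
    from qmat_ideal_flip[OF qmat_ideal_relations(2)[OF ids lt, of "inverse lam" ?q, unfolded qs] this]
    show ?thesis using anti s by simp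
  next
    case (row m i j)
    have ids: "{?r i, ?r j, ?r i, ?r m} \<subseteq> {1..n}" using mem row(1) by blast
    have lt: "?r m < ?r j" using less row by auto
    have qs: "?q (?r m) (?r j) = p m j" using q row(1) by auto
    have "p j m * p m j = 1" using inv row(1) by simp
    from qmat_ideal_flip[OF qmat_ideal_relations(3)[OF ids lt, of ?q "inverse lam", unfolded qs] this]
    show ?thesis using row s by simp
  qed
qed

lemma param_matrix_rotate:
  assumes "param_matrix n p" shows "param_matrix n (rotate_params n p)"
proof -
  have r: "n + 1 - i \<in> {1..n}" if "i \<in> {1..n}" for i using that by auto
  have ne: "n + 1 - i \<noteq> n + 1 - j" if "i \<in> {1..n}" "j \<in> {1..n}" "i \<noteq> j" for i j using that by auto
  show ?thesis
    using assms r ne unfolding param_matrix_def rotate_params_def by blast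
qed

lemma qmat_iso_rotate:
  fixes lam :: "'k::field"
  assumes p: "param_matrix n p" and lam: "lam \<noteq> 0"
  shows "is_algebra_iso (qmat_algebra n lam p) (qmat_algebra n (inverse lam) (rotate_params n p))"
proof -
  interpret index_involution "rotate_index n" n by (rule index_involution_rotate)
  show ?thesis
  proof (rule qmat_iso_rename)
    fix r assume r: "r \<in> qmat_relations n (inverse lam) (rotate_params n p)"
    have "rename r \<in> qmat_ideal n (inverse (inverse lam)) (rotate_params n (rotate_params n p))"
      by (rule rename_relation_rotate[OF param_matrix_rotate[OF p] _ r]) (simp add: lam)
    also have "\<dots> = qmat_ideal n (inverse (inverse lam)) p"
      by (rule qmat_cong(2)) (simp add: rotate_params_def)
    finally show "rename r \<in> qmat_ideal n lam p" by simp
  qed (rule rename_relation_rotate[OF p lam])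
qed

section \<open>Composition of isomorphisms and the classification\<close>

lemma is_algebra_iso_refl: "is_algebra_iso A A"
proof -
  have "id \<in> algebra_iso A A" using ring_iso_set_refl[of A] by (simp add: algebra_iso_def)
  then show ?thesis unfolding is_algebra_iso_def by blast
qed

lemma is_algebra_iso_trans:
  assumes "is_algebra_iso A B" "is_algebra_iso B C"
  shows "is_algebra_iso A C"
proof -
  obtain f g where fg: "f \<in> ring_iso A B" "\<And>c x. x \<in> carrier A \<Longrightarrow> f (c \<odot>\<^bsub>A\<^esub> x) = c \<odot>\<^bsub>B\<^esub> f x"
    "g \<in> ring_iso B C" "\<And>c x. x \<in> carrier B \<Longrightarrow> g (c \<odot>\<^bsub>B\<^esub> x) = c \<odot>\<^bsub>C\<^esub> g x"
    using assms unfolding is_algebra_iso_def algebra_iso_def by blast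
  have "g \<circ> f \<in> algebra_iso A C"
    using ring_iso_set_trans[OF fg(1,3)] fg(2,4) ring_iso_memE(1)[OF fg(1)]
    by (simp add: algebra_iso_def)
  then show ?thesis unfolding is_algebra_iso_def by blast
qed

theorem theorem4:
  fixes lam mu :: "'k::field" and p q :: "nat \<Rightarrow> nat \<Rightarrow> 'k" and n m :: nat
  assumes "n \<ge> 2" and "m \<ge> 2"
    and "lam \<noteq> 0" and "lam \<noteq> 1" and "lam \<noteq> - 1"
    and "mu \<noteq> 0" and "mu \<noteq> 1" and "mu \<noteq> - 1"
    and "param_matrix n p" and "param_matrix m q"
  shows "is_algebra_iso (qmat_algebra n lam p) (qmat_algebra m mu q) \<longleftrightarrow>
    n = m \<and>
    ((lam = mu \<and> (\<forall>i\<in>{1..n}. \<forall>j\<in>{1..n}. p i j = q i j)) \<or>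
     (lam = mu \<and> (\<forall>i\<in>{1..n}. \<forall>j\<in>{1..n}. i > j \<longrightarrow> p i j = inverse lam * q j i)) \<or>
     (lam = inverse mu \<and>
       (\<forall>i\<in>{1..n}. \<forall>j\<in>{1..n}. p i j = q (n + 1 - i) (n + 1 - j))) \<or>
     (lam = inverse mu \<and>
       (\<forall>i\<in>{1..n}. \<forall>j\<in>{1..n}. i > j \<longrightarrow>
          p i j = inverse lam * q (n + 1 - j) (n + 1 - i))))"
  (is "?iso \<longleftrightarrow> n = m \<and> ?params")
proof
  assume ?iso
  then obtain H K where HK: "qmat_lift_pair n m lam mu p q H K"
    by (rule alg_iso_lift)
  have "qmat_iso_lift n m lam mu p q H K"
    using HK assms unfolding qmat_iso_lift_def qmat_iso_lift_axioms_def by blast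
  then interpret qmat_iso_lift n m lam mu p q H K .
  have "param_matrix n q" using assms(10) size_eq by simp
  obtain s t where "bij_betw s (idx n) (idx n)" "\<And>x. x \<in> idx n \<Longrightarrow> t x \<noteq> 0"
    "\<And>b. quad_dual n mu q b \<Longrightarrow> quad_dual n lam p (\<lambda>x y. t x * t y * b (s x) (s y))"
    using monomial by blast
  then have "monomial_iso n lam mu p q s t"
    using assms \<open>param_matrix n q\<close> by unfold_locales
  from monomial_iso.params[OF this] size_eq show "n = m \<and> ?params" by blast
next
  assume R: "n = m \<and> ?params"
  then have nm: "m = n" by simp
  have q: "param_matrix n q" using assms(10) nm by simp
  have inv: "p i j * p j i = 1" if "i \<in> {1..n}" "j \<in> {1..n}" for i j
    using param_matrix_inv[OF assms(9), of i j] that by simp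
  \<comment> \<open>Two of the cases prescribe \<open>p\<close> only below the diagonal. Since
    opposite entries of \<open>p\<close> and of \<open>r\<close> are mutually inverse, this fixes
    the whole matrix; \<open>r\<close> will be \<open>q\<close> or its rotation.\<close>
  have transposed: "transpose_params lam p i j = r i j"
    if lower: "\<And>i j. i \<in> {1..n} \<Longrightarrow> j \<in> {1..n} \<Longrightarrow> j < i \<Longrightarrow> p i j = inverse lam * r j i"
      and r: "param_matrix n r" and ij: "i \<in> {1..n}" "j \<in> {1..n}" for i j r
  proof (cases i j rule: linorder_cases)
    case less
    then show ?thesis using lower[OF ij(2,1)] assms(3) by (simp add: transpose_params_def)
  next
    case equal
    then show ?thesis using r ij unfolding param_matrix_def transpose_params_def by simp
  next
    case greater
    have "p i j * p j i = 1" "r j i * r i j = 1" using inv ij param_matrix_inv[OF r] by auto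
    then have "r j i * r i j = 1" "r j i * (inverse lam * p j i) = 1"
      using lower[OF ij greater] by (simp_all add: mult_ac)
    then show ?thesis using greater by (simp add: transpose_params_def) (metis inverse_unique)
  qed
  from R have ?params by blast
  then show ?iso
    unfolding nm
  proof (elim disjE conjE)
    assume "lam = mu" "\<forall>i\<in>{1..n}. \<forall>j\<in>{1..n}. p i j = q i j"
    then show "is_algebra_iso (qmat_algebra n lam p) (qmat_algebra n mu q)"
      using qmat_cong(1)[of n p q lam] is_algebra_iso_refl by metis
  next
    assume "lam = mu" and l: "\<forall>i\<in>{1..n}. \<forall>j\<in>{1..n}. i > j \<longrightarrow> p i j = inverse lam * q j i"
    have "qmat_algebra n lam (transpose_params lam p) = qmat_algebra n lam q"
      by (rule qmat_cong(1), rule transposed[OF _ q]) (use l in auto)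
    with qmat_iso_transpose[OF assms(9,3)] \<open>lam = mu\<close>
    show "is_algebra_iso (qmat_algebra n lam p) (qmat_algebra n mu q)" by simp
  next
    assume "lam = inverse mu" and l: "\<forall>i\<in>{1..n}. \<forall>j\<in>{1..n}. p i j = q (n + 1 - i) (n + 1 - j)"
    have "rotate_params n p i j = q i j" if "i \<in> {1..n}" "j \<in> {1..n}" for i j
    proof -
      have "n + 1 - i \<in> {1..n}" "n + 1 - j \<in> {1..n}" using that by auto
      then have "p (n + 1 - i) (n + 1 - j) = q (n + 1 - (n + 1 - i)) (n + 1 - (n + 1 - j))" using l by blast
      then show ?thesis using that by (simp add: rotate_params_def)
    qed
    then have "qmat_algebra n (inverse lam) (rotate_params n p) = qmat_algebra n (inverse lam) q"
      by (rule qmat_cong(1))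
    with qmat_iso_rotate[OF assms(9,3)] \<open>lam = inverse mu\<close>
    show "is_algebra_iso (qmat_algebra n lam p) (qmat_algebra n mu q)" by simp
  next
    assume "lam = inverse mu" and l: "\<forall>i\<in>{1..n}. \<forall>j\<in>{1..n}. i > j \<longrightarrow>
        p i j = inverse lam * q (n + 1 - j) (n + 1 - i)"
    \<comment> \<open>Here the isomorphism is a transposition followed by a rotation, and the
      intermediate parameters are those of the rotated \<open>q\<close>.\<close>
    have *: "transpose_params lam p i j = rotate_params n q i j" if "i \<in> {1..n}" "j \<in> {1..n}" for i j
      by (rule transposed[OF _ param_matrix_rotate[OF q] that]) (use l in \<open>auto simp: rotate_params_def\<close>)
    have "rotate_params n (transpose_params lam p) i j = q i j" if "i \<in> {1..n}" "j \<in> {1..n}" for i j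
    proof -
      have "n + 1 - i \<in> {1..n}" "n + 1 - j \<in> {1..n}" using that by auto
      from *[OF this] show ?thesis using that by (simp add: rotate_params_def)
    qed
    then have "qmat_algebra n (inverse lam) (rotate_params n (transpose_params lam p)) = qmat_algebra n (inverse lam) q"
      by (rule qmat_cong(1))
    with is_algebra_iso_trans[OF qmat_iso_transpose[OF assms(9,3)]
        qmat_iso_rotate[OF param_matrix_transpose[OF assms(9,3)] assms(3)]] \<open>lam = inverse mu\<close>
    show "is_algebra_iso (qmat_algebra n lam p) (qmat_algebra n mu q)" by simp
  qed
qed

end
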